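(* Let $(\mu_1,\mu_2)\in\mathbb R^2$, let $\mathbb D\subset\mathbb C$ be a simply-connected domain with base point $z_*\in\mathbb D$, and let $\varphi=(\varphi^1,\varphi^2,\varphi^3):\mathbb D\to G(\mu_1,\mu_2)$ be a ${}^{(0)}\nabla$-harmonic map with $\varphi(z_* )=\mathrm{id}$. Then $\varphi$ can be represented by some meromorphic functions $\xi^k(z)$ $(k=1,2,3)$ on $\mathbb D$ as follows: $$\varphi^{k}(z,\bar z)=\exp\Big(-2\mu_k\,\mathrm{Re}\int_{z_*}^z\xi^3(t)\,dt\Big)\Big(\tilde f^{k}(z,\bar z,-1)-\tilde f^{k}(z,\bar z,1)\Big)\quad(k=1,2),$$ $$\varphi^3(z,\bar z)=-4\,\mathrm{Re}\int_{z_*}^z\xi^3(t)\,dt .$$ Here, for $k=1,2$, $\tilde f^k(z,\bar z,\lambda)$ is the real part in the Iwasawa decomposition $g^k=\tilde f^k+g^k_+$ of the scalar loop $$g^k(z,\bar z,\lambda)=\lambda^{-1}\exp\Big(-2\mu_k\,\mathrm{Re}\big(\lambda^{-1}\textstyle\int_{z_*}^z\xi^3(t)\,dt\big)\Big)\int_{z_*}^z\xi^k(t)\exp\Big(\lambda^{-1}\mu_k\int_{z_*}^t\xi^3(s)\,ds\Big)dt .$$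
   Context: $G(\mu_1,\mu_2)$ is the Lie group $\mathbb R^3$ with multiplication $$(x^1,x^2,x^3)\cdot(\hat x^1,\hat x^2,\hat x^3)=(x^1+e^{\mu_1x^3}\hat x^1,\;x^2+e^{\mu_2x^3}\hat x^2,\;x^3+\hat x^3);$$ for $(\mu_1,\mu_2)\neq(0,0)$ it is realized as the group of matrices $\begin{pmatrix}e^{\mu_1x^3}&0&x^1\\0&e^{\mu_2x^3}&x^2\\0&0&1\end{pmatrix}$. The neutral connection ${}^{(0)}\nabla$ is the bi-invariant connection with ${}^{(0)}\nabla_XY=\frac12[X,Y]$ for left-invariant vector fields $X,Y$. A smooth map $\varphi$ from a Riemann surface into a manifold with affine connection $\nabla$ is $\nabla$-harmonic if $\mathrm{tr}_g(\nabla d\varphi)=0$ for a (any) Hermitian metric $g$ in the conformal class, where $(\nabla d\varphi)(Y;X)=\nabla^\varphi_Xd\varphi(Y)-d\varphi(\nabla^M_XY)$, with $\nabla^\varphi$ the connection induced on the pull-back of the tangent bundle and $\nabla^M$ the Levi-Civita connection of $g$. For maps into $G(\mu_1,\mu_2)$, ${}^{(0)}\nabla$-harmonicity amounts to $\varphi^k_{z\bar z}-\frac12\mu_k(\varphi^k_z\varphi^3_{\bar z}+\varphi^k_{\bar z}\varphi^3_z)=0$ $(k=1,2)$ and $\varphi^3_{z\bar z}=0$. For a loop $f(z,\bar z,\lambda)$, the real part is $\mathrm{Re}(f(z,\bar z,\lambda))=\frac12\big(f(z,\bar z,\lambda)+\overline{f(z,\bar z,1/\bar\lambda)}\big)$,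 which is real for $\lambda\in\mathbb S^1$. The Iwasawa decomposition of a scalar loop $g^k(z,\bar z,\lambda)=\sum_{j\in\mathbb Z}g^k_j(z,\bar z)\lambda^j$ is $g^k=\tilde f^k+g^k_+$ with $$\tilde f^k=\sum_{j<0}\big(g^k_j\lambda^j+\overline{g^k_j}\lambda^{-j}\big),\qquad g^k_+=\sum_{j\ge0}g^k_j\lambda^j-\sum_{j<0}\overline{g^k_j}\lambda^{-j}.$$ Expressions involving the meromorphic functions $\xi^k$ are understood away from their poles. *)

theory Defs
  imports "HOL-Complex_Analysis.Complex_Analysis"
begin

no_notation fps_nth (infixl "$" 75)

section \<open>Smooth maps on open sets\<close>

fun Ck_on :: "nat \<Rightarrow> 'a::real_normed_vector set \<Rightarrow> ('a \<Rightarrow> 'b::real_normed_vector) \<Rightarrow> bool" where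
  "Ck_on 0 S f \<longleftrightarrow> continuous_on S f"
| "Ck_on (Suc n) S f \<longleftrightarrow> (\<forall>x\<in>S. f differentiable (at x)) \<and>
     (\<forall>v. Ck_on n S (\<lambda>x. frechet_derivative f (at x) v))"

definition smooth_map_on :: "'a::real_normed_vector set \<Rightarrow> ('a \<Rightarrow> 'b::real_normed_vector) \<Rightarrow> bool" where
  "smooth_map_on S f \<longleftrightarrow> (\<forall>n. Ck_on n S f)"

section \<open>Affine connections in a global chart\<close>

text \<open>
  All manifolds occurring here (the group and the plane domain) carry one global chart, in which
  an affine connection is the flat derivative plus a bilinear Christoffel term:
  \<open>C p v w\<close> is the covariant derivative at \<open>p\<close>, in the direction \<open>v\<close>, of the constant field \<open>w\<close>.
  Vector fields are maps of the underlying vector space to itself.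
\<close>

type_synonym 'a christoffel = "'a \<Rightarrow> 'a \<Rightarrow> 'a \<Rightarrow> 'a"

definition cov_deriv ::
    "'a::real_normed_vector christoffel \<Rightarrow> ('a \<Rightarrow> 'a) \<Rightarrow> ('a \<Rightarrow> 'a) \<Rightarrow> 'a \<Rightarrow> 'a" where
  "cov_deriv C X Y p = frechet_derivative Y (at p) (X p) + C p (X p) (Y p)"

definition lie_bracket :: "('a::real_normed_vector \<Rightarrow> 'a) \<Rightarrow> ('a \<Rightarrow> 'a) \<Rightarrow> 'a \<Rightarrow> 'a" where
  "lie_bracket X Y p = frechet_derivative Y (at p) (X p) - frechet_derivative X (at p) (Y p)"

section \<open>The group and its neutral connection\<close>

definition G_mult :: "real \<Rightarrow> real \<Rightarrow> real^3 \<Rightarrow> real^3 \<Rightarrow> real^3" where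
  "G_mult \<mu>1 \<mu>2 x y = vector [x$1 + exp (\<mu>1 * x$3) * y$1, x$2 + exp (\<mu>2 * x$3) * y$2, x$3 + y$3]"

definition left_invariant :: "real \<Rightarrow> real \<Rightarrow> (real^3 \<Rightarrow> real^3) \<Rightarrow> bool" where
  "left_invariant \<mu>1 \<mu>2 X \<longleftrightarrow>
     (\<forall>a x. X (G_mult \<mu>1 \<mu>2 a x) = frechet_derivative (G_mult \<mu>1 \<mu>2 a) (at x) (X x))"

text \<open>
  Left-invariant fields span every tangent space, so the last condition determines \<open>C\<close>;
  existence and uniqueness are proved below.
\<close>

definition neutral_connection :: "real \<Rightarrow> real \<Rightarrow> (real^3) christoffel \<Rightarrow> bool" where
  "neutral_connection \<mu>1 \<mu>2 C \<longleftrightarrow> (\<forall>p. bilinear (C p)) \<and>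
     (\<forall>X Y. left_invariant \<mu>1 \<mu>2 X \<longrightarrow> left_invariant \<mu>1 \<mu>2 Y \<longrightarrow>
        (\<forall>p. cov_deriv C X Y p = (1/2) *\<^sub>R lie_bracket X Y p))"

lemma G_mult_id: "G_mult \<mu>1 \<mu>2 0 x = x" "G_mult \<mu>1 \<mu>2 x 0 = x"
  by (simp_all add: G_mult_def vec_eq_iff forall_3 vector_3)

lemma vector3_axis:
  "(vector [a, b, c] :: real^3) = a *\<^sub>R axis 1 1 + b *\<^sub>R axis 2 1 + c *\<^sub>R axis 3 1"
  by (simp add: vec_eq_iff forall_3 vector_3 axis_def)

lemma G_mult_has_derivative:
  "(G_mult \<mu>1 \<mu>2 a has_derivative
      (\<lambda>v. vector [exp (\<mu>1 * a$3) * v$1, exp (\<mu>2 * a$3) * v$2, v$3])) (at x)"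
  unfolding G_mult_def[abs_def] vector3_axis
  by (auto intro!: derivative_eq_intros bounded_linear.has_derivative[OF bounded_linear_vec_nth])

lemma left_invariant_iff:
  "left_invariant \<mu>1 \<mu>2 X \<longleftrightarrow>
     (\<exists>c :: real^3. X = (\<lambda>x. vector [exp (\<mu>1 * x$3) * c$1, exp (\<mu>2 * x$3) * c$2, c$3]))" (is "_ \<longleftrightarrow> ?R")
proof -
  have D: "frechet_derivative (G_mult \<mu>1 \<mu>2 a) (at x) =
      (\<lambda>v. vector [exp (\<mu>1 * a$3) * v$1, exp (\<mu>2 * a$3) * v$2, v$3])" for a x
    using frechet_derivative_at[OF G_mult_has_derivative] by metis
  show ?thesis
  proof
    assume "left_invariant \<mu>1 \<mu>2 X"
    then have "X a = vector [exp (\<mu>1 * a$3) * X 0$1, exp (\<mu>2 * a$3) * X 0$2, X 0$3]" for a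
      unfolding left_invariant_def D using G_mult_id(2) by metis
    then show ?R by (intro exI[of _ "X 0"] ext)
  next
    assume ?R
    then show "left_invariant \<mu>1 \<mu>2 X"
      by (auto simp: left_invariant_def D G_mult_def vec_eq_iff forall_3 vector_3 exp_add algebra_simps)
  qed
qed

lemma left_field_derivative:
  fixes c :: "real^3"
  shows "frechet_derivative (\<lambda>x::real^3. vector [exp (\<mu>1 * x$3) * c$1, exp (\<mu>2 * x$3) * c$2, c$3] :: real^3) (at p) =
     (\<lambda>v. vector [\<mu>1 * v$3 * (exp (\<mu>1 * p$3) * c$1), \<mu>2 * v$3 * (exp (\<mu>2 * p$3) * c$2), 0])"
proof (rule frechet_derivative_at[symmetric])
  show "((\<lambda>x::real^3. vector [exp (\<mu>1 * x$3) * c$1, exp (\<mu>2 * x$3) * c$2, c$3] :: real^3) has_derivative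
     (\<lambda>v. vector [\<mu>1 * v$3 * (exp (\<mu>1 * p$3) * c$1), \<mu>2 * v$3 * (exp (\<mu>2 * p$3) * c$2), 0])) (at p)"
    unfolding vector3_axis
    by (auto intro!: derivative_eq_intros bounded_linear.has_derivative[OF bounded_linear_vec_nth]
        simp: algebra_simps)
qed

lemma neutral_connection_iff:
  "neutral_connection \<mu>1 \<mu>2 C \<longleftrightarrow>
     C = (\<lambda>p v w. vector [- (\<mu>1/2) * (v$3 * w$1 + v$1 * w$3), - (\<mu>2/2) * (v$3 * w$2 + v$2 * w$3), 0])"
    (is "_ \<longleftrightarrow> C = ?C")
proof
  assume N: "neutral_connection \<mu>1 \<mu>2 C"
  show "C = ?C"
  proof (intro ext)
    fix p v w :: "real^3"
    define F where "F u = (\<lambda>x::real^3. vector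
       [exp (\<mu>1 * x$3) * (exp (- \<mu>1 * p$3) * u$1), exp (\<mu>2 * x$3) * (exp (- \<mu>2 * p$3) * u$2), u$3] :: real^3)"
      for u :: "real^3"
    have F': "F u = (\<lambda>x. let c = vector [exp (- \<mu>1 * p$3) * u$1, exp (- \<mu>2 * p$3) * u$2, u$3] :: real^3
        in vector [exp (\<mu>1 * x$3) * c$1, exp (\<mu>2 * x$3) * c$2, c$3])" for u
      by (simp add: F_def vector_3)
    have L: "left_invariant \<mu>1 \<mu>2 (F u)" for u
      unfolding left_invariant_iff F' Let_def
      by (rule exI[of _ "vector [exp (- \<mu>1 * p$3) * u$1, exp (- \<mu>2 * p$3) * u$2, u$3]"]) (rule refl)
    have Fp: "F u p = u" for u
      by (simp add: F_def vec_eq_iff forall_3 vector_3 exp_minus)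
    have D: "frechet_derivative (F u) (at p) = (\<lambda>v. vector [\<mu>1 * v$3 * u$1, \<mu>2 * v$3 * u$2, 0])" for u
      unfolding F' Let_def left_field_derivative by (simp add: vector_3 exp_minus fun_eq_iff vec_eq_iff forall_3)
    have "cov_deriv C (F v) (F w) p = (1/2) *\<^sub>R lie_bracket (F v) (F w) p"
      using N L unfolding neutral_connection_def by blast
    then have "C p v w = (1/2) *\<^sub>R lie_bracket (F v) (F w) p - frechet_derivative (F w) (at p) v"
      by (simp add: cov_deriv_def Fp algebra_simps)
    then show "C p v w = ?C p v w"
      by (simp add: lie_bracket_def Fp D vec_eq_iff forall_3 vector_3 field_simps)
  qed
next
  assume C: "C = ?C"
  have "bilinear (C p)" for p
    unfolding C bilinear_def
    by (auto intro!: linearI simp: vec_eq_iff forall_3 vector_3 algebra_simps add_divide_distrib)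
  moreover have "cov_deriv C X Y p = (1/2) *\<^sub>R lie_bracket X Y p"
    if "left_invariant \<mu>1 \<mu>2 X" "left_invariant \<mu>1 \<mu>2 Y" for X Y p
    using that unfolding left_invariant_iff C
    apply clarify
    apply (simp only: cov_deriv_def lie_bracket_def left_field_derivative)
    apply (simp add: vec_eq_iff forall_3 vector_3 field_simps)
    done
  ultimately show "neutral_connection \<mu>1 \<mu>2 C"
    unfolding neutral_connection_def by blast
qed

section \<open>Harmonic maps into a manifold with affine connection\<close>

text \<open>
  A Hermitian metric in the conformal class of a plane domain is \<open>g = \<rho> (dx\<^sup>2 + dy\<^sup>2)\<close> with
  \<open>\<rho>\<close> smooth and positive; here \<open>\<bullet>\<close> on \<open>complex\<close> is the Euclidean inner product.
  The condition on \<open>L\<close> below says that it is torsion-free and that \<open>g\<close> is parallel.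
\<close>

definition hermitian_metric_on :: "complex set \<Rightarrow> (complex \<Rightarrow> real) \<Rightarrow> bool" where
  "hermitian_metric_on D \<rho> \<longleftrightarrow> smooth_map_on D \<rho> \<and> (\<forall>z\<in>D. \<rho> z > 0)"

definition levi_civita_on :: "complex set \<Rightarrow> (complex \<Rightarrow> real) \<Rightarrow> complex christoffel \<Rightarrow> bool" where
  "levi_civita_on D \<rho> L \<longleftrightarrow> (\<forall>z\<in>D. bilinear (L z) \<and> (\<forall>u v. L z u v = L z v u) \<and>
     (\<forall>u v w. frechet_derivative (\<lambda>x. \<rho> x * (v \<bullet> w)) (at z) u =
        \<rho> z * (L z u v \<bullet> w) + \<rho> z * (v \<bullet> L z u w)))"

text \<open>Induced connection on sections \<open>s\<close> of the pull-back of the tangent bundle along \<open>\<phi>\<close>.\<close>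

definition pullback_deriv ::
    "'b::real_normed_vector christoffel \<Rightarrow> (complex \<Rightarrow> 'b) \<Rightarrow> (complex \<Rightarrow> complex) \<Rightarrow> (complex \<Rightarrow> 'b) \<Rightarrow> complex \<Rightarrow> 'b"
  where "pullback_deriv C \<phi> X s z =
     frechet_derivative s (at z) (X z) + C (\<phi> z) (frechet_derivative \<phi> (at z) (X z)) (s z)"

definition nabla_d ::
    "'b::real_normed_vector christoffel \<Rightarrow> complex christoffel \<Rightarrow> (complex \<Rightarrow> 'b) \<Rightarrow>
      (complex \<Rightarrow> complex) \<Rightarrow> (complex \<Rightarrow> complex) \<Rightarrow> complex \<Rightarrow> 'b"
  where "nabla_d C L \<phi> Y X z =
     pullback_deriv C \<phi> X (\<lambda>w. frechet_derivative \<phi> (at w) (Y w)) z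
       - frechet_derivative \<phi> (at z) (cov_deriv L X Y z)"

text \<open>
  \<open>nabla_d\<close> is tensorial in both fields, so its trace is evaluated on the constant frame
  \<open>1, \<i>\<close> (\<open>Basis\<close> of \<open>complex\<close>), which is orthogonal with squared length \<open>\<rho> z\<close>.
\<close>

definition harmonic_map_on ::
    "'b::real_normed_vector christoffel \<Rightarrow> complex set \<Rightarrow> (complex \<Rightarrow> 'b) \<Rightarrow> bool" where
  "harmonic_map_on C D \<phi> \<longleftrightarrow> smooth_map_on D \<phi> \<and>
     (\<exists>\<rho> L. hermitian_metric_on D \<rho> \<and> levi_civita_on D \<rho> L \<and>
        (\<forall>z\<in>D. (\<Sum>b\<in>Basis. (1 / \<rho> z) *\<^sub>R nabla_d C L \<phi> (\<lambda>_. b) (\<lambda>_. b) z) = 0))"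

section \<open>Scalar loops\<close>

definition loop_Re :: "(complex \<Rightarrow> complex) \<Rightarrow> complex \<Rightarrow> complex" where
  "loop_Re f \<zeta> = (f \<zeta> + cnj (f (1 / cnj \<zeta>))) / 2"

text \<open>
  \<open>g = f + gp\<close> on the unit circle, where the sums run over all Laurent coefficients \<open>c j\<close> of \<open>g\<close>.
  Since \<open>has_sum\<close> is unconditional convergence, the \<open>c j\<close> are the Fourier coefficients of \<open>g\<close>,
  so \<open>f\<close> and \<open>gp\<close> are determined by \<open>g\<close> on the circle.
\<close>

definition iwasawa_decomposition ::
    "(complex \<Rightarrow> complex) \<Rightarrow> (complex \<Rightarrow> complex) \<Rightarrow> (complex \<Rightarrow> complex) \<Rightarrow> bool" where
  "iwasawa_decomposition g f gp \<longleftrightarrow> (\<exists>c :: int \<Rightarrow> complex. \<forall>\<zeta>\<in>sphere 0 1.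
     ((\<lambda>j. c j * \<zeta> powi j) has_sum g \<zeta>) UNIV \<and>
     ((\<lambda>j. c j * \<zeta> powi j + cnj (c j) * \<zeta> powi (- j)) has_sum f \<zeta>) {..<0} \<and>
     ((\<lambda>j. if j \<ge> 0 then c j * \<zeta> powi j else - cnj (c j) * \<zeta> powi (- j)) has_sum gp \<zeta>) UNIV \<and>
     g \<zeta> = f \<zeta> + gp \<zeta>)"

text \<open>
  \<open>\<gamma>\<close> is a path from the base point to \<open>z\<close>; all integrals are taken along it. The outer integral
  is written out as in \<open>has_contour_integral\<close>, because the inner integral, from the base point to
  \<open>t = \<gamma> s\<close>, is taken along the initial piece of \<open>\<gamma>\<close> and hence depends on \<open>s\<close>.
\<close>

definition scalar_loop ::
    "real \<Rightarrow> (complex \<Rightarrow> complex) \<Rightarrow> (complex \<Rightarrow> complex) \<Rightarrow> (real \<Rightarrow> complex) \<Rightarrow> complex \<Rightarrow> complex" where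
  "scalar_loop \<mu> \<xi>k \<xi>3 \<gamma> \<zeta> =
     inverse \<zeta> * exp (- 2 * of_real \<mu> * loop_Re (\<lambda>\<eta>. inverse \<eta> * contour_integral \<gamma> \<xi>3) \<zeta>) *
     integral {0..1} (\<lambda>s. \<xi>k (\<gamma> s) *
       exp (inverse \<zeta> * of_real \<mu> * contour_integral (subpath 0 s \<gamma>) \<xi>3) *
       vector_derivative \<gamma> (at s within {0..1}))"

end

theory Submission
  imports Defs
begin

text \<open>
  The third equation of the system says that \<open>\<phi>\<^sup>3\<close> is harmonic, so \<open>\<phi>\<^sup>3 = - 4 Re h\<close> for a
  holomorphic \<open>h\<close> vanishing at the base point, and \<open>\<xi>\<^sup>3 = h'\<close>. For \<open>k = 1, 2\<close> the substitution
  \<open>u = exp (2 \<mu> Re h) \<phi>\<^sup>k\<close> removes the first order terms and leaves the linear equation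
  \<open>4 \<mu>\<^sup>2 |h'|\<^sup>2 u = \<Delta> u\<close> for a real function \<open>u\<close> that vanishes at the base point.

  This equation is the integrability condition of a loop of real one-forms. For \<open>|\<lambda>| = 1\<close> put
  \<open>E = \<mu> (\<lambda>\<inverse> h + \<lambda> cnj h)\<close>, which is real; the form \<open>- Re (exp E (\<lambda>\<inverse> u\<^sub>z + \<mu> h' u) dz)\<close> is
  closed. Let \<open>K\<close> be its primitive that vanishes at the base point. At \<open>\<lambda> = 1\<close> and \<open>\<lambda> = - 1\<close> the
  form is the differential of \<open>- exp E u / 2\<close> and of \<open>exp E u / 2\<close>, respectively, so \<open>K\<close> has these
  values there, and the real loop \<open>R = exp (- E) K\<close> satisfies \<open>R(-1) - R(1) = u\<close>.

  The holomorphic data are found by a splitting in \<open>\<lambda>\<close>. The loop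
  \<open>k = exp (\<mu> \<lambda> cnj h) R = exp (- \<mu> \<lambda>\<inverse> h) K\<close> has a derivative with respect to \<open>cnj z\<close> that
  contains only nonnegative powers of \<open>\<lambda>\<close>. Therefore its coefficients \<open>k\<^sub>j\<close> with \<open>j < 0\<close> are
  holomorphic in \<open>z\<close>, and comparing powers in the derivative with respect to \<open>z\<close> gives
  \<open>k\<^sub>j' = - \<mu> h' k\<^sub>j\<^sub>+\<^sub>1\<close> for \<open>j < - 1\<close>. With \<open>\<xi> = k\<^sub>-\<^sub>1'\<close> this recursion is solved by iterated
  primitives, and the negative part of \<open>k\<close> is \<open>\<lambda>\<inverse> exp (- \<mu> \<lambda>\<inverse> h) \<integral> \<xi> exp (\<mu> \<lambda>\<inverse> h)\<close>.
  Multiplication by \<open>exp (- \<mu> \<lambda> cnj h)\<close>, a power series in \<open>\<lambda>\<close>, turns this negative part into the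
  scalar loop \<open>g\<close> of the theorem and \<open>k\<close> into \<open>R\<close>; hence \<open>g\<close> and \<open>R\<close> have the same negative
  coefficients. As \<open>R\<close> is real, the real part of the Iwasawa decomposition of \<open>g\<close> is \<open>R\<close> without
  its constant coefficient, which cancels in the difference of the values at \<open>- 1\<close> and \<open>1\<close>.

  These steps are \<open>loop_primitive_deriv\<close>, \<open>loop_primitive_at_units\<close>, \<open>mode_deriv\<close>,
  \<open>sums_of_iterated_primitives\<close> and \<open>iwasawa_of_real_loop\<close>. The primitive of a closed form is
  integrated along segments, which needs a convex domain; the equation is conformally invariant,
  and the Riemann mapping theorem carries the result to simply connected domains
  (\<open>simply_connected_representation\<close>).
\<close>

section \<open>Absolutely convergent Laurent series on the unit circle\<close>

text \<open>
  Two notions of absolute summability share an infix; below it means unconditional summability of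
  the norms.
\<close>

no_notation Infinite_Set_Sum.abs_summable_on (infix "abs'_summable'_on" 50)

definition wiener_loop :: "(complex \<Rightarrow> complex) \<Rightarrow> (int \<Rightarrow> complex) \<Rightarrow> bool" where
  "wiener_loop F c \<longleftrightarrow> c abs_summable_on UNIV \<and>
     (\<forall>\<zeta>\<in>sphere 0 1. ((\<lambda>j. c j * \<zeta> powi j) has_sum F \<zeta>) UNIV)"

lemma norm_powi_circle: "norm (\<zeta>::complex) = 1 \<Longrightarrow> norm (\<zeta> powi j) = 1"
  by (simp add: norm_power_int)

lemma cnj_circle: "norm \<zeta> = 1 \<Longrightarrow> cnj \<zeta> = inverse \<zeta>"
  by (metis complex_norm_square inverse_unique of_real_1 power_one)

text \<open>
  Expansions often arise with a larger index set, such as pairs of exponents. Absolute convergence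
  permits collecting the terms that belong to one power.
\<close>

lemma wiener_loop_regroup:
  fixes a :: "'i \<Rightarrow> complex" and e :: "'i \<Rightarrow> int"
  assumes abs: "a abs_summable_on X"
    and sum: "\<And>\<zeta>. norm \<zeta> = 1 \<Longrightarrow> ((\<lambda>x. a x * \<zeta> powi e x) has_sum F \<zeta>) X"
  shows "wiener_loop F (\<lambda>j. \<Sum>\<^sub>\<infinity>x\<in>{x\<in>X. e x = j}. a x)"
proof -
  define B where "B j = {x\<in>X. e x = j}" for j
  have bij: "bij_betw (\<lambda>x. (e x, x)) X (Sigma UNIV B)"
    by (rule bij_betwI[where g = snd]) (auto simp: B_def)
  have absB: "(\<lambda>p. a (snd p)) abs_summable_on Sigma UNIV B"
    using abs by (subst summable_on_reindex_bij_betw[OF bij, symmetric]) simp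
  have inner: "a abs_summable_on B j" for j
    using abs by (rule summable_on_subset_banach) (auto simp: B_def)
  have "(\<lambda>j. infsum (\<lambda>x. norm (a x)) (B j)) abs_summable_on UNIV"
    using absB unfolding Infinite_Sum.abs_summable_on_Sigma_iff by simp
  then have "(\<lambda>j. infsum (\<lambda>x. norm (a x)) (B j)) summable_on UNIV"
    by (rule abs_summable_summable)
  then have 1: "(\<lambda>j. infsum a (B j)) abs_summable_on UNIV"
    by (rule Infinite_Sum.abs_summable_on_comparison_test') (use inner in \<open>auto intro: norm_infsum_bound\<close>)
  have 2: "((\<lambda>j. infsum a (B j) * \<zeta> powi j) has_sum F \<zeta>) UNIV" if "norm \<zeta> = 1" for \<zeta>
  proof (rule has_sum_Sigma'[where B = B])
    show "((\<lambda>p. a (snd p) * \<zeta> powi (fst p)) has_sum F \<zeta>) (Sigma UNIV B)"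
      using sum[OF that] by (subst has_sum_reindex_bij_betw[OF bij, symmetric]) simp
    show "((\<lambda>x. a (snd (j, x)) * \<zeta> powi fst (j, x)) has_sum infsum a (B j) * \<zeta> powi j) (B j)" for j
      using abs_summable_summable[OF inner[of j]]
      by (auto intro!: has_sum_cmult_left has_sum_infsum)
  qed
  show ?thesis
    using 1 2 unfolding wiener_loop_def B_def by simp
qed

lemma has_sum_product_abs:
  fixes a :: "'i \<Rightarrow> complex" and b :: "'j \<Rightarrow> complex"
  assumes "a abs_summable_on X" "b abs_summable_on Y" "(a has_sum s) X" "(b has_sum t) Y"
  shows "(\<lambda>(x, y). a x * b y) abs_summable_on X \<times> Y"
    and "((\<lambda>(x, y). a x * b y) has_sum s * t) (X \<times> Y)"
proof -
  show *: "(\<lambda>(x, y). a x * b y) abs_summable_on X \<times> Y"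
    unfolding Infinite_Sum.abs_summable_on_Sigma_iff
    using assms(1,2)
    by (auto simp: norm_mult abs_mult infsum_cmult_right' intro!: summable_on_cmult_right summable_on_cmult_left)
  show "((\<lambda>(x, y). a x * b y) has_sum s * t) (X \<times> Y)"
    by (rule has_sum_SigmaI[where g = "\<lambda>x. a x * t"])
      (use assms abs_summable_summable[OF *] in \<open>auto intro!: has_sum_cmult_left has_sum_cmult_right\<close>)
qed

lemma wiener_loop_mult:
  assumes F: "wiener_loop F a" and G: "wiener_loop G b"
  shows "wiener_loop (\<lambda>\<zeta>. F \<zeta> * G \<zeta>) (\<lambda>j. \<Sum>\<^sub>\<infinity>p\<in>{p\<in>UNIV \<times> UNIV. fst p + snd p = j}. a (fst p) * b (snd p))"
proof (rule wiener_loop_regroup)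
  have a: "a abs_summable_on UNIV" and b: "b abs_summable_on UNIV"
    using F G by (auto simp: wiener_loop_def)
  show "(\<lambda>p. a (fst p) * b (snd p)) abs_summable_on UNIV \<times> UNIV"
    using has_sum_product_abs(1)[OF a b has_sum_infsum has_sum_infsum,
        OF abs_summable_summable[OF a] abs_summable_summable[OF b]]
    by (simp only: case_prod_unfold)
  fix \<zeta> :: complex assume z: "norm \<zeta> = 1"
  then have nz: "\<zeta> \<noteq> 0" by auto
  have *: "(\<lambda>m. c m * \<zeta> powi m) abs_summable_on UNIV" if "c abs_summable_on UNIV" for c
    using that z by (simp add: norm_mult norm_powi_circle)
  have "((\<lambda>m. a m * \<zeta> powi m) has_sum F \<zeta>) UNIV" "((\<lambda>m. b m * \<zeta> powi m) has_sum G \<zeta>) UNIV"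
    using F G z by (auto simp: wiener_loop_def)
  then have "((\<lambda>p. (a (fst p) * \<zeta> powi fst p) * (b (snd p) * \<zeta> powi snd p)) has_sum F \<zeta> * G \<zeta>) (UNIV \<times> UNIV)"
    using has_sum_product_abs(2)[OF *[OF a] *[OF b]] by (simp only: case_prod_unfold)
  moreover have "(a (fst p) * \<zeta> powi fst p) * (b (snd p) * \<zeta> powi snd p) =
      a (fst p) * b (snd p) * \<zeta> powi (fst p + snd p)" for p
    using nz by (simp add: power_int_add)
  ultimately show "((\<lambda>p. a (fst p) * b (snd p) * \<zeta> powi (fst p + snd p)) has_sum F \<zeta> * G \<zeta>) (UNIV \<times> UNIV)"
    by (simp only:)
qed

lemma wiener_loop_add:
  assumes "wiener_loop F a" "wiener_loop G b"
  shows "wiener_loop (\<lambda>\<zeta>. F \<zeta> + G \<zeta>) (\<lambda>j. a j + b j)"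
proof -
  have "(\<lambda>j. a j + b j) abs_summable_on UNIV"
    using assms unfolding wiener_loop_def
    by (intro Infinite_Sum.abs_summable_on_comparison_test'[where g = "\<lambda>j. norm (a j) + norm (b j)"])
      (auto intro!: summable_on_add norm_triangle_ineq)
  then show ?thesis
    using assms unfolding wiener_loop_def
    by (auto simp: algebra_simps intro!: has_sum_add)
qed

lemma wiener_loop_cmult:
  assumes "wiener_loop F a"
  shows "wiener_loop (\<lambda>\<zeta>. k * F \<zeta>) (\<lambda>j. k * a j)"
  using assms unfolding wiener_loop_def
  by (auto simp: norm_mult mult.assoc intro!: has_sum_cmult_right summable_on_cmult_right)

lemma exp_powers_sum:
  fixes x :: complex
  shows "(\<lambda>n. x ^ n / fact n) abs_summable_on UNIV"
    and "((\<lambda>n. x ^ n / fact n) has_sum exp x) UNIV"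
proof -
  have eq: "x ^ n / fact n = x ^ n /\<^sub>R fact n" for n
    by (simp add: scaleR_conv_of_real divide_inverse mult.commute)
  show "((\<lambda>n. x ^ n / fact n) has_sum exp x) UNIV"
    unfolding eq by (rule norm_summable_imp_has_sum[OF summable_norm_exp exp_converges])
  show "(\<lambda>n. x ^ n / fact n) abs_summable_on UNIV"
    unfolding eq using summable_norm_exp[of x]
    by (intro norm_summable_imp_summable_on) (simp only: real_norm_def abs_norm_cancel)
qed

lemma wiener_loop_exp:
  "wiener_loop (\<lambda>\<zeta>. exp (x * \<zeta>)) (\<lambda>j. if j < 0 then 0 else x ^ nat j / fact (nat j))"
proof -
  have "wiener_loop (\<lambda>\<zeta>. exp (x * \<zeta>)) (\<lambda>j. \<Sum>\<^sub>\<infinity>n\<in>{n\<in>UNIV. int n = j}. x ^ n / fact n)"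
    using exp_powers_sum(1)[of x] exp_powers_sum(2)[of "x * _"]
    by (intro wiener_loop_regroup) (simp_all add: power_mult_distrib)
  moreover have "(\<Sum>\<^sub>\<infinity>n\<in>{n\<in>UNIV. int n = j}. x ^ n / fact n) = (if j < 0 then 0 else x ^ nat j / fact (nat j))" for j
  proof (cases "j < 0")
    case True
    then have "{n\<in>UNIV. int n = j} = {}" by auto
    then show ?thesis using True by simp
  next
    case False
    then have "{n\<in>UNIV. int n = j} = {nat j}" by auto
    then show ?thesis using False by simp
  qed
  ultimately show ?thesis by simp
qed

lemma has_sum_integral:
  fixes f :: "'i \<Rightarrow> real \<Rightarrow> complex"
  assumes "\<And>i. i \<in> X \<Longrightarrow> continuous_on {a..b} (f i)"
    and "\<And>i t. i \<in> X \<Longrightarrow> t \<in> {a..b} \<Longrightarrow> norm (f i t) \<le> M i"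
    and "M summable_on X"
    and sum: "\<And>t. t \<in> {a..b} \<Longrightarrow> ((\<lambda>i. f i t) has_sum F t) X"
  shows "((\<lambda>i. integral {a..b} (f i)) has_sum integral {a..b} F) X"
proof -
  define f' where "f' i t = (if i \<in> X then f i t else 0)" for i t
  define g where "g S t = (\<Sum>i\<in>S. f' i t)" for S t
  have u: "uniform_limit {a..b} g F (finite_subsets_at_top X)"
    unfolding g_def
  proof (rule Weierstrass_m_test_general'[OF _ _ assms(3)])
    show "norm (f' i t) \<le> M i" if "i \<in> X" "t \<in> {a..b}" for i t
      using assms(2) that by (simp add: f'_def)
    show "((\<lambda>i. f' i t) has_sum F t) X" if "t \<in> {a..b}" for t
      using sum[OF that] by (rule has_sum_cong[THEN iffD1, rotated]) (simp add: f'_def)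
  qed
  have c: "continuous_on {a..b} (g S)" for S
    unfolding g_def f'_def using assms(1) by (intro continuous_on_sum) (case_tac "i \<in> X"; simp)
  obtain I J where I: "\<And>S. (g S has_integral I S) {a..b}" and J: "(F has_integral J) {a..b}"
      and lim: "(I \<longlongrightarrow> J) (finite_subsets_at_top X)"
    using uniform_limit_integral[OF u c finite_subsets_at_top_neq_bot] by blast
  have "((\<lambda>S. \<Sum>i\<in>S. integral {a..b} (f i)) \<longlongrightarrow> J) (finite_subsets_at_top X)"
  proof (rule Lim_transform_eventually[OF lim])
    have "I S = (\<Sum>i\<in>S. integral {a..b} (f i))" if "finite S" "S \<subseteq> X" for S
    proof -
      have "g S = (\<lambda>t. \<Sum>i\<in>S. f i t)"
        using that by (auto simp: g_def f'_def fun_eq_iff intro!: sum.cong)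
      then have "I S = integral {a..b} (\<lambda>t. \<Sum>i\<in>S. f i t)"
        using integral_unique[OF I[of S]] by simp
      also have "\<dots> = (\<Sum>i\<in>S. integral {a..b} (f i))"
        using that assms(1) by (intro integral_sum) (auto intro!: integrable_continuous_real)
      finally show ?thesis .
    qed
    then show "\<forall>\<^sub>F S in finite_subsets_at_top X. I S = (\<Sum>i\<in>S. integral {a..b} (f i))"
      by (intro eventually_finite_subsets_at_top_weakI) auto
  qed
  then show ?thesis
    using J by (simp add: has_sum_def integral_unique)
qed

definition fourier_coeff :: "(complex \<Rightarrow> complex) \<Rightarrow> int \<Rightarrow> complex" where
  "fourier_coeff F j = integral {0..2*pi} (\<lambda>\<theta>. cis (- of_int j * \<theta>) * F (cis \<theta>)) / (2 * pi)"

lemma cis_powi: "cis \<theta> powi j = cis (of_int j * \<theta>)"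
  by (simp add: cis_power_int)

lemma integral_cis_int:
  "integral {0..2*pi} (\<lambda>\<theta>. cis (of_int m * \<theta>)) = (if m = 0 then 2 * pi else 0)"
proof (cases "m = 0")
  case False
  define f where "f z = - \<i> / of_int m * exp (\<i> * of_int m * z)" for z :: complex
  have "((\<lambda>\<theta>. f (of_real \<theta>)) has_vector_derivative cis (of_int m * \<theta>)) (at \<theta> within {0..2*pi})" for \<theta>
    using False unfolding f_def
    by (intro has_vector_derivative_real_field) (auto intro!: derivative_eq_intros simp: cis_conv_exp mult_ac)
  then have "((\<lambda>\<theta>. cis (of_int m * \<theta>)) has_integral f (of_real (2*pi)) - f (of_real 0)) {0..2*pi}"
    by (intro fundamental_theorem_of_calculus) auto
  moreover have "cis (of_int m * (2*pi)) = 1"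
    using cis_powi[of "2*pi" m] by simp
  ultimately show ?thesis using False by (simp add: integral_unique f_def cis_conv_exp mult_ac)
qed (simp add: scaleR_conv_of_real)

text \<open>
  Integrating the series termwise against \<open>cis (- j \<theta>)\<close> leaves one term. This gives uniqueness of
  the coefficients, and expresses them by integrals that can be differentiated in a parameter.
\<close>

lemma wiener_loop_coeff:
  assumes "wiener_loop F c"
  shows "fourier_coeff F j = c j"
proof -
  have "((\<lambda>i. integral {0..2*pi} (\<lambda>\<theta>. c i * cis (of_int (i - j) * \<theta>))) has_sum
      integral {0..2*pi} (\<lambda>\<theta>. cis (- of_int j * \<theta>) * F (cis \<theta>))) UNIV"
  proof (rule has_sum_integral)
    show "(\<lambda>i. norm (c i)) summable_on UNIV" using assms by (simp add: wiener_loop_def)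
    fix t
    have "((\<lambda>i. cis (- of_int j * t) * (c i * cis t powi i)) has_sum cis (- of_int j * t) * F (cis t)) UNIV"
      using assms by (intro has_sum_cmult_right) (auto simp: wiener_loop_def)
    moreover have "cis (- of_int j * t) * (c i * cis t powi i) = c i * cis (of_int (i - j) * t)" for i
      by (simp add: cis_powi cis_mult algebra_simps)
    ultimately show "((\<lambda>i. c i * cis (of_int (i - j) * t)) has_sum cis (- of_int j * t) * F (cis t)) UNIV"
      by (simp only:)
    show "continuous_on {0..2*pi} (\<lambda>\<theta>. c i * cis (of_int (i - j) * \<theta>))" for i
      by (intro continuous_on_mult continuous_on_const continuous_on_cis continuous_on_id)
  qed (simp add: norm_mult)
  moreover have "integral {0..2*pi} (\<lambda>\<theta>. c i * cis (of_int (i - j) * \<theta>)) = (if i = j then c j * (2*pi) else 0)" for i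
    unfolding integral_mult_right integral_cis_int by simp
  ultimately have "((\<lambda>i. if i = j then c j * (2*pi) else 0) has_sum
      integral {0..2*pi} (\<lambda>\<theta>. cis (- of_int j * \<theta>) * F (cis \<theta>))) UNIV"
    by simp
  moreover have "((\<lambda>i. if i = j then c j * (2*pi) else 0) has_sum c j * (2*pi)) UNIV"
    using has_sum_finite_neutralI[of "{j}" UNIV "\<lambda>i. if i = j then c j * (2*pi) else 0" "c j * (2*pi)"] by auto
  ultimately have "integral {0..2*pi} (\<lambda>\<theta>. cis (- of_int j * \<theta>) * F (cis \<theta>)) = c j * (2*pi)"
    by (rule has_sum_unique)
  then show ?thesis by (simp add: fourier_coeff_def)
qed

lemma continuous_on_bounded_unit:
  fixes f :: "real \<Rightarrow> complex"
  assumes "continuous_on {0..1} f"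
  obtains R where "R \<ge> 0" "\<And>t. t \<in> {0..1} \<Longrightarrow> norm (f t) \<le> R"
proof -
  have "bounded (f ` {0..1})"
    using assms by (intro compact_imp_bounded compact_continuous_image) auto
  then obtain R where R: "\<forall>t\<in>{0..1}. norm (f t) \<le> R" by (auto simp: bounded_iff)
  then have "0 \<le> R" using order_trans[OF norm_ge_zero, of "f 0" R] by auto
  with R that show thesis by blast
qed

text \<open>
  Expanding both exponentials gives a series over pairs \<open>(m, n)\<close> with terms of degree \<open>m - n\<close>,
  dominated uniformly in \<open>t\<close> by a product of two exponential series; so it may be integrated
  termwise. The loops of primitives constructed below are sums of integrals of this kind.
\<close>

lemma wiener_loop_exp_integral:
  fixes H A :: "real \<Rightarrow> complex"
  assumes H: "continuous_on {0..1} H" and A: "continuous_on {0..1} A"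
  obtains c where "wiener_loop (\<lambda>\<zeta>. integral {0..1} (\<lambda>t. exp (cnj (H t) * \<zeta> + H t * cnj \<zeta>) * A t)) c"
proof -
  obtain R where R0: "R \<ge> 0" and R: "\<And>t. t \<in> {0..1} \<Longrightarrow> norm (H t) \<le> R"
    using continuous_on_bounded_unit[OF H] by blast
  obtain S where S0: "S \<ge> 0" and S: "\<And>t. t \<in> {0..1} \<Longrightarrow> norm (A t) \<le> S"
    using continuous_on_bounded_unit[OF A] by blast
  define T where "T = (\<lambda>(m, n) t. (cnj (H t) ^ m / fact m) * (H t ^ n / fact n) * A t)"
  define M where "M = (\<lambda>(m, n). (R ^ m / fact m) * (R ^ n / fact n) * S)"
  have cT: "continuous_on {0..1} (T p)" for p
    unfolding T_def case_prod_unfold using assms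
    by (intro continuous_on_mult continuous_on_divide continuous_on_power continuous_on_cnj
        continuous_on_const) auto
  have nT: "norm (T p t) \<le> M p" if "t \<in> {0..1}" for p t
  proof -
    have *: "norm (x ^ n / fact n) \<le> R ^ n / fact n" if "norm x \<le> R" for x :: complex and n
      using that by (simp add: norm_divide norm_power divide_right_mono power_mono)
    obtain m n where "p = (m, n)" by fastforce
    moreover have "norm ((cnj (H t) ^ m / fact m) * (H t ^ n / fact n) * A t) \<le> (R ^ m / fact m) * (R ^ n / fact n) * S"
      unfolding norm_mult using R[OF that] S[OF that] R0 S0
      by (intro mult_mono *) auto
    ultimately show ?thesis by (simp add: T_def M_def)
  qed
  have "(\<lambda>(m, n). (of_real R ^ m / fact m) * (of_real R ^ n / fact n :: complex)) abs_summable_on UNIV \<times> UNIV"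
    using exp_powers_sum by (intro has_sum_product_abs(1)) auto
  then have "(\<lambda>p. (case p of (m, n) \<Rightarrow> (R ^ m / fact m) * (R ^ n / fact n)) * S) summable_on UNIV"
    using R0 by (intro summable_on_cmult_left) (simp add: case_prod_unfold norm_mult norm_divide norm_power)
  then have sM: "M summable_on UNIV"
    by (simp add: M_def case_prod_unfold)
  have sumT: "((\<lambda>p. T p t * \<zeta> powi (int (fst p) - int (snd p))) has_sum exp (cnj (H t) * \<zeta> + H t * cnj \<zeta>) * A t) UNIV"
    if "norm \<zeta> = 1" for t \<zeta>
  proof -
    have z: "cnj \<zeta> = inverse \<zeta>" "\<zeta> \<noteq> 0"
      using that cnj_circle by auto
    have "((\<lambda>(m, n). ((cnj (H t) * \<zeta>) ^ m / fact m) * ((H t * cnj \<zeta>) ^ n / fact n)) has_sum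
        exp (cnj (H t) * \<zeta>) * exp (H t * cnj \<zeta>)) (UNIV \<times> UNIV)"
      by (rule has_sum_product_abs(2)) (rule exp_powers_sum)+
    then have "((\<lambda>p. (\<lambda>(m, n). ((cnj (H t) * \<zeta>) ^ m / fact m) * ((H t * cnj \<zeta>) ^ n / fact n)) p * A t) has_sum
        exp (cnj (H t) * \<zeta>) * exp (H t * cnj \<zeta>) * A t) UNIV"
      by (intro has_sum_cmult_left) simp
    moreover have "(\<lambda>(m, n). ((cnj (H t) * \<zeta>) ^ m / fact m) * ((H t * cnj \<zeta>) ^ n / fact n)) p * A t
        = T p t * \<zeta> powi (int (fst p) - int (snd p))" for p
      using z(2) by (simp add: T_def case_prod_unfold power_mult_distrib z(1) power_int_diff
          power_inverse divide_inverse mult_ac)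
    ultimately show ?thesis by (simp add: exp_add)
  qed
  have "wiener_loop (\<lambda>\<zeta>. integral {0..1} (\<lambda>t. exp (cnj (H t) * \<zeta> + H t * cnj \<zeta>) * A t))
     (\<lambda>j. \<Sum>\<^sub>\<infinity>p\<in>{p\<in>UNIV. int (fst p) - int (snd p) = j}. integral {0..1} (T p))"
  proof (rule wiener_loop_regroup)
    show "(\<lambda>p. integral {0..1} (T p)) abs_summable_on UNIV"
      using sM
    proof (rule Infinite_Sum.abs_summable_on_comparison_test')
      show "norm (integral {0..1} (T p)) \<le> M p" for p
        using integral_bound[of 0 1 "T p" "M p"] cT nT by auto
    qed
    fix \<zeta> :: complex assume z: "norm \<zeta> = 1"
    have "((\<lambda>p. integral {0..1} (\<lambda>t. T p t * \<zeta> powi (int (fst p) - int (snd p)))) has_sum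
         integral {0..1} (\<lambda>t. exp (cnj (H t) * \<zeta> + H t * cnj \<zeta>) * A t)) UNIV"
    proof (rule has_sum_integral[OF _ _ sM])
      show "continuous_on {0..1} (\<lambda>t. T p t * \<zeta> powi (int (fst p) - int (snd p)))" for p
        by (intro continuous_on_mult cT continuous_on_const)
      show "norm (T p t * \<zeta> powi (int (fst p) - int (snd p))) \<le> M p" if "t \<in> {0..1}" for p t
        using nT[OF that] z by (simp add: norm_mult norm_powi_circle)
    qed (rule sumT[OF z])
    then show "((\<lambda>p. integral {0..1} (T p) * \<zeta> powi (int (fst p) - int (snd p))) has_sum
         integral {0..1} (\<lambda>t. exp (cnj (H t) * \<zeta> + H t * cnj \<zeta>) * A t)) UNIV"
      by simp
  qed
  then show thesis by (rule that)
qed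

lemma wiener_loop_cong:
  assumes "wiener_loop F c" "\<And>\<zeta>. norm \<zeta> = 1 \<Longrightarrow> F \<zeta> = G \<zeta>"
  shows "wiener_loop G c"
  using assms unfolding wiener_loop_def by simp

lemma wiener_loop_abs_summable_restrict:
  assumes "wiener_loop F c" "norm \<zeta> = 1"
  shows "(\<lambda>j. c j * \<zeta> powi j) abs_summable_on A"
  using assms summable_on_subset_banach[of "\<lambda>j. norm (c j)" UNIV A]
  by (simp add: wiener_loop_def norm_mult norm_powi_circle)

lemma wiener_loop_cnj:
  assumes "wiener_loop F c"
  shows "wiener_loop (\<lambda>\<zeta>. cnj (F \<zeta>)) (\<lambda>j. cnj (c (- j)))"
proof -
  have bij: "bij_betw (uminus :: int \<Rightarrow> int) UNIV UNIV"
    by (rule bij_uminus)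
  have 1: "(\<lambda>j. norm (cnj (c (- j)))) summable_on UNIV"
    using assms summable_on_reindex_bij_betw[OF bij, of "\<lambda>j. norm (c j)"]
    by (simp add: wiener_loop_def)
  have 2: "((\<lambda>j. cnj (c (- j)) * \<zeta> powi j) has_sum cnj (F \<zeta>)) UNIV" if z: "norm \<zeta> = 1" for \<zeta>
  proof -
    have "((\<lambda>j. cnj (c j * \<zeta> powi j)) has_sum cnj (F \<zeta>)) UNIV"
      using assms z by (intro has_sum_bounded_linear[OF bounded_linear_cnj, unfolded o_def]) (simp add: wiener_loop_def)
    then have "((\<lambda>j. cnj (c (- j) * \<zeta> powi (- j))) has_sum cnj (F \<zeta>)) UNIV"
      by (subst (asm) has_sum_reindex_bij_betw[OF bij, symmetric]) simp
    moreover have "cnj (\<zeta> powi (- j)) = \<zeta> powi j" for j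
    proof -
      have "cnj (\<zeta> powi (- j)) = cnj \<zeta> powi (- j)" by (simp add: power_int_def)
      also have "\<dots> = \<zeta> powi j" unfolding cnj_circle[OF z] by (simp add: power_int_minus power_int_inverse)
      finally show ?thesis .
    qed
    ultimately show ?thesis by simp
  qed
  show ?thesis unfolding wiener_loop_def using 1 2 by simp
qed

lemma wiener_loop_unique:
  assumes "wiener_loop F a" "wiener_loop F b"
  shows "a = b"
  using wiener_loop_coeff[OF assms(1)] wiener_loop_coeff[OF assms(2)] by (simp add: fun_eq_iff)


lemma wiener_loop_shift:
  assumes "wiener_loop F c"
  shows "wiener_loop (\<lambda>\<zeta>. \<zeta> powi k * F \<zeta>) (\<lambda>j. c (j - k))"
proof -
  have bij: "bij_betw (\<lambda>j::int. j - k) UNIV UNIV"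
    by (rule bij_betwI[where g = "\<lambda>j. j + k"]) auto
  have 1: "(\<lambda>j. norm (c (j - k))) summable_on UNIV"
    using assms summable_on_reindex_bij_betw[OF bij, of "\<lambda>j. norm (c j)"]
    by (simp add: wiener_loop_def)
  have 2: "((\<lambda>j. c (j - k) * \<zeta> powi j) has_sum \<zeta> powi k * F \<zeta>) UNIV" if z: "norm \<zeta> = 1" for \<zeta>
  proof -
    have nz: "\<zeta> \<noteq> 0" using z by auto
    have "((\<lambda>j. c j * \<zeta> powi j) has_sum F \<zeta>) UNIV"
      using assms z by (simp add: wiener_loop_def)
    then have "((\<lambda>j. c (j - k) * \<zeta> powi (j - k)) has_sum F \<zeta>) UNIV"
      by (subst has_sum_reindex_bij_betw[OF bij])
    from has_sum_cmult_right[OF this, of "\<zeta> powi k"]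
    show ?thesis using nz by (simp add: power_int_diff)
  qed
  show ?thesis unfolding wiener_loop_def using 1 2 by simp
qed

lemma wiener_loop_exp_cnj:
  obtains c where "wiener_loop (\<lambda>\<zeta>. exp (x * cnj \<zeta>)) c"
  using wiener_loop_cnj[OF wiener_loop_exp[of "cnj x"]] by (auto simp: exp_cnj)

text \<open>
  The real part of the decomposition of \<open>g\<close> is the negative part of \<open>g\<close> plus its conjugate. Reality
  of \<open>R\<close> means \<open>\<phi> (- j) = cnj (\<phi> j)\<close>, so this is \<open>R\<close> with the constant coefficient removed.
\<close>

lemma iwasawa_of_real_loop:
  assumes R: "wiener_loop R \<phi>" and real: "\<And>\<zeta>. norm \<zeta> = 1 \<Longrightarrow> cnj (R \<zeta>) = R \<zeta>"
    and g: "wiener_loop g c" and neg: "\<And>j. j < 0 \<Longrightarrow> c j = \<phi> j"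
  shows "\<exists>f gp. iwasawa_decomposition g f gp \<and> f (-1) - f 1 = R (-1) - R 1"
proof -
  have sym: "\<phi> (- j) = cnj (\<phi> j)" for j
  proof -
    have "wiener_loop R (\<lambda>j. cnj (\<phi> (- j)))"
      by (rule wiener_loop_cong[OF wiener_loop_cnj[OF R] real])
    from wiener_loop_unique[OF R this] have "\<phi> (- j) = cnj (\<phi> (- (- j)))" by metis
    then show ?thesis by simp
  qed
  define f where "f \<zeta> = R \<zeta> - \<phi> 0" for \<zeta>
  have "((\<lambda>j. c j * \<zeta> powi j) has_sum g \<zeta>) UNIV \<and>
     ((\<lambda>j. c j * \<zeta> powi j + cnj (c j) * \<zeta> powi (- j)) has_sum f \<zeta>) {..<0} \<and>
     ((\<lambda>j. if j \<ge> 0 then c j * \<zeta> powi j else - cnj (c j) * \<zeta> powi (- j)) has_sum (g \<zeta> - f \<zeta>)) UNIV \<and>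
     g \<zeta> = f \<zeta> + (g \<zeta> - f \<zeta>)" if "\<zeta> \<in> sphere 0 1" for \<zeta>
  proof -
    have z: "norm \<zeta> = 1" using that by simp
    have sg: "((\<lambda>j. c j * \<zeta> powi j) has_sum g \<zeta>) UNIV"
      using g that by (simp add: wiener_loop_def)
    have sR: "((\<lambda>j. \<phi> j * \<zeta> powi j) has_sum R \<zeta>) UNIV"
      using R that by (simp add: wiener_loop_def)
    define N where "N = infsum (\<lambda>j. c j * \<zeta> powi j) {..<0}"
    define N' where "N' = infsum (\<lambda>j. \<phi> j * \<zeta> powi j) {0<..}"
    have N: "((\<lambda>j. c j * \<zeta> powi j) has_sum N) {..<0}"
      unfolding N_def by (rule has_sum_infsum) (rule abs_summable_summable[OF wiener_loop_abs_summable_restrict[OF g z]])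
    have N2: "((\<lambda>j. \<phi> j * \<zeta> powi j) has_sum N) {..<0}"
      using N by (rule has_sum_cong[THEN iffD1, rotated]) (simp add: neg)
    have "((\<lambda>j. \<phi> j * \<zeta> powi j) has_sum N') {0<..}"
      unfolding N'_def by (rule has_sum_infsum) (rule abs_summable_summable[OF wiener_loop_abs_summable_restrict[OF R z]])
    moreover have bij: "bij_betw (uminus :: int \<Rightarrow> int) {..<0} {0<..}"
      by (rule bij_betwI[where g = uminus]) auto
    ultimately have "((\<lambda>j. \<phi> (- j) * \<zeta> powi (- j)) has_sum N') {..<0}"
      by (subst has_sum_reindex_bij_betw[OF bij])
    then have N': "((\<lambda>j. cnj (c j) * \<zeta> powi (- j)) has_sum N') {..<0}"
      by (rule has_sum_cong[THEN iffD1, rotated]) (simp add: sym neg)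
    have "((\<lambda>j. \<phi> j * \<zeta> powi j) has_sum \<phi> 0 * \<zeta> powi 0) {0}"
      by (rule has_sum_finiteI) auto
    then have "((\<lambda>j. \<phi> j * \<zeta> powi j) has_sum (N + (\<phi> 0 * \<zeta> powi 0 + N'))) ({..<0} \<union> ({0} \<union> {0<..}))"
      using N2 \<open>(_ has_sum N') {0<..}\<close> by (intro has_sum_Un_disjoint) auto
    moreover have "{..<0} \<union> ({0} \<union> {0<..}) = (UNIV :: int set)" by auto
    ultimately have "R \<zeta> = N + (\<phi> 0 + N')"
      using has_sum_unique[OF sR] by simp
    then have f: "f \<zeta> = N + N'" by (simp add: f_def)
    have "((\<lambda>j. c j * \<zeta> powi j) has_sum (g \<zeta> - N)) (UNIV - {..<0})"
      by (rule has_sum_Diff[OF sg N]) auto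
    then have p: "((\<lambda>j. if j \<ge> 0 then c j * \<zeta> powi j else - cnj (c j) * \<zeta> powi (- j)) has_sum (g \<zeta> - N)) (UNIV - {..<0})"
      by (rule has_sum_cong[THEN iffD1, rotated]) auto
    have "((\<lambda>j. - (cnj (c j) * \<zeta> powi (- j))) has_sum - N') {..<0}"
      using N' by (simp add: has_sum_uminus)
    then have m: "((\<lambda>j. if j \<ge> 0 then c j * \<zeta> powi j else - cnj (c j) * \<zeta> powi (- j)) has_sum - N') {..<0}"
      by (rule has_sum_cong[THEN iffD1, rotated]) auto
    have "((\<lambda>j. if j \<ge> 0 then c j * \<zeta> powi j else - cnj (c j) * \<zeta> powi (- j)) has_sum (g \<zeta> - N + - N')) ((UNIV - {..<0}) \<union> {..<0})"
      by (rule has_sum_Un_disjoint[OF p m]) auto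
    moreover have "(UNIV - {..<0}) \<union> {..<0} = (UNIV :: int set)" by auto
    ultimately show ?thesis
      using sg has_sum_add[OF N N'] by (simp add: f diff_diff_add)
  qed
  then have "iwasawa_decomposition g f (\<lambda>\<zeta>. g \<zeta> - f \<zeta>)"
    unfolding iwasawa_decomposition_def by blast
  moreover have "f (-1) - f 1 = R (-1) - R 1" by (simp add: f_def)
  ultimately show ?thesis by blast
qed

section \<open>Primitives on convex domains\<close>

lemma has_derivative_exp_complex:
  fixes g :: "'a::real_normed_vector \<Rightarrow> complex"
  assumes "(g has_derivative g') (at z)"
  shows "((\<lambda>x. exp (g x)) has_derivative (\<lambda>v. exp (g z) * g' v)) (at z)"
  using has_derivative_compose[OF assms DERIV_exp[of "g z", unfolded has_field_derivative_def]] .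

lemma convex_radial_mem:
  fixes w0 :: complex
  assumes "convex S" "w0 \<in> S" "z \<in> S" "t \<in> {0..1}"
  shows "w0 + of_real t * (z - w0) \<in> S"
proof -
  have "(1 - t) *\<^sub>R w0 + t *\<^sub>R z \<in> S"
    using assms by (intro convexD) auto
  then show ?thesis by (simp add: scaleR_conv_of_real algebra_simps)
qed

text \<open>
  This is the Poincare lemma for the form \<open>Re (c dz)\<close>, which is closed because the coefficient of
  \<open>cnj v\<close> in the derivative of \<open>c\<close> is real. That reality lets \<open>v\<close> and \<open>z - w0\<close> be interchanged in
  the derivative of the integrand, which thereby becomes \<open>Re (W v)\<close> where \<open>W\<close> is the derivative of
  \<open>t c(w0 + t (z - w0))\<close> with respect to \<open>t\<close>.
\<close>

lemma radial_primitive: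
  fixes c \<alpha> :: "complex \<Rightarrow> complex" and \<beta> :: "complex \<Rightarrow> real"
  assumes S: "open S" "convex S" "w0 \<in> S" "z0 \<in> S"
    and c': "\<And>z. z \<in> S \<Longrightarrow> (c has_derivative (\<lambda>v. \<alpha> z * v + of_real (\<beta> z) * cnj v)) (at z)"
    and cont: "continuous_on S \<alpha>" "continuous_on S \<beta>"
  shows "((\<lambda>z. integral {0..1} (\<lambda>t. Re (c (w0 + of_real t * (z - w0)) * (z - w0))))
           has_derivative (\<lambda>v. Re (c z0 * v))) (at z0)"
proof -
  define \<gamma> where "\<gamma> z t = w0 + of_real t * (z - w0)" for z and t :: real
  \<comment> \<open>both the derivative of \<open>t c(\<gamma> z t)\<close> and the coefficient of \<open>v\<close> in the derivative of the integrand in \<open>z\<close>\<close>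
  define W where "W z t = c (\<gamma> z t) + of_real t * (\<alpha> (\<gamma> z t) * (z - w0) + of_real (\<beta> (\<gamma> z t)) * cnj (z - w0))" for z t
  have \<gamma>S: "\<gamma> z t \<in> S" if "z \<in> S" "t \<in> {0..1}" for z t
    using convex_radial_mem S that unfolding \<gamma>_def by blast
  have contc: "continuous_on S c"
    using c' has_derivative_continuous continuous_at_imp_continuous_on by blast
  have cont\<gamma>: "continuous_on (S \<times> {0..1}) (\<lambda>(z, t). \<gamma> z t)"
    unfolding \<gamma>_def case_prod_unfold by (intro continuous_intros)
  have comp: "continuous_on (S \<times> {0..1}) (\<lambda>(z, t). f (\<gamma> z t))" if "continuous_on S f" for f :: "complex \<Rightarrow> 'b::topological_space"
    using continuous_on_compose2[OF that cont\<gamma>] \<gamma>S by (force simp: case_prod_unfold)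
  have contW: "continuous_on (S \<times> {0..1}) (\<lambda>(z, t). W z t)"
    using comp[OF contc] comp[OF cont(1)] comp[OF cont(2)] unfolding W_def case_prod_unfold
    by (intro continuous_intros)
  have contPair: "continuous_on {0..1} (Pair z)" for z :: complex
    by (rule continuous_on_Pair[OF continuous_on_const continuous_on_id])
  have contWz: "continuous_on {0..1} (W z)" if "z \<in> S" for z
    using continuous_on_compose2[OF contW contPair[of z]] that by auto
  have contfz: "continuous_on {0..1} (\<lambda>t. c (\<gamma> z t))" if "z \<in> S" for z
    using continuous_on_compose2[OF comp[OF contc] contPair[of z]] that by auto
  define fx where "fx z t = blinfun_inner_right (cnj (W z t))" for z t
  have inner_eq: "blinfun_apply (blinfun_inner_right (cnj w)) v = Re (w * v)" for w v
    by (simp add: inner_complex_def)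
  have L: "((\<lambda>z. integral (cbox 0 1) (\<lambda>t. Re (c (\<gamma> z t) * (z - w0)))) has_derivative
      blinfun_apply (integral (cbox 0 1) (fx z0))) (at z0 within S)"
  proof (rule leibniz_rule[OF _ _ _ S(4,2)])
    fix z t assume z: "z \<in> S" and t: "t \<in> cbox 0 (1::real)"
    have d\<gamma>: "((\<lambda>z. \<gamma> z t) has_derivative (\<lambda>v. of_real t * v)) (at z)"
      unfolding \<gamma>_def by (auto intro!: derivative_eq_intros)
    have "((\<lambda>z. c (\<gamma> z t)) has_derivative (\<lambda>v. \<alpha> (\<gamma> z t) * (of_real t * v) + of_real (\<beta> (\<gamma> z t)) * cnj (of_real t * v))) (at z)"
      using has_derivative_compose[OF d\<gamma> c'[OF \<gamma>S[OF z]]] t by auto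
    then have "((\<lambda>z. Re (c (\<gamma> z t) * (z - w0))) has_derivative
       (\<lambda>v. Re (c (\<gamma> z t) * v + (\<alpha> (\<gamma> z t) * (of_real t * v) + of_real (\<beta> (\<gamma> z t)) * cnj (of_real t * v)) * (z - w0)))) (at z)"
      by (auto intro!: derivative_eq_intros)
    moreover have "Re (c (\<gamma> z t) * v + (\<alpha> (\<gamma> z t) * (of_real t * v) + of_real (\<beta> (\<gamma> z t)) * cnj (of_real t * v)) * (z - w0))
        = blinfun_apply (fx z t) v" for v
      unfolding fx_def inner_eq W_def by (simp add: algebra_simps)
    ultimately show "((\<lambda>z. Re (c (\<gamma> z t) * (z - w0))) has_derivative blinfun_apply (fx z t)) (at z within S)"
      by (auto intro: has_derivative_at_withinI)
  next
    fix z assume "z \<in> S"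
    then show "(\<lambda>t. Re (c (\<gamma> z t) * (z - w0))) integrable_on cbox 0 1"
      using contfz by (auto intro!: integrable_continuous_real continuous_intros)
  next
    show "continuous_on (S \<times> cbox 0 1) (\<lambda>(z, t). fx z t)"
      using contW unfolding fx_def case_prod_unfold
      by (intro bounded_linear.continuous_on[OF bounded_linear_blinfun_inner_right] continuous_on_cnj) simp
  qed
  have int_W: "integral {0..1} (W z0) = c z0"
  proof -
    have "((\<lambda>t. of_real t * c (\<gamma> z0 t)) has_vector_derivative W z0 t) (at t within {0..1})" if "t \<in> {0..1}" for t
    proof -
      have d\<gamma>: "((\<lambda>t. \<gamma> z0 t) has_derivative (\<lambda>s. of_real s * (z0 - w0))) (at t)"
        unfolding \<gamma>_def by (auto intro!: derivative_eq_intros)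
      have "((\<lambda>t. c (\<gamma> z0 t)) has_derivative (\<lambda>s. \<alpha> (\<gamma> z0 t) * (of_real s * (z0 - w0)) + of_real (\<beta> (\<gamma> z0 t)) * cnj (of_real s * (z0 - w0)))) (at t)"
        using has_derivative_compose[OF d\<gamma> c'[OF \<gamma>S[OF S(4) that]]] by auto
      then have "((\<lambda>t. of_real t * c (\<gamma> z0 t)) has_derivative (\<lambda>s. s *\<^sub>R W z0 t)) (at t)"
        by (auto intro!: derivative_eq_intros simp: W_def scaleR_conv_of_real algebra_simps)
      then show ?thesis by (simp add: has_vector_derivative_def has_derivative_at_withinI)
    qed
    then have "(W z0 has_integral (of_real 1 * c (\<gamma> z0 1) - of_real 0 * c (\<gamma> z0 0))) {0..1}"
      by (intro fundamental_theorem_of_calculus) auto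
    then show ?thesis by (simp add: integral_unique \<gamma>_def)
  qed
  have "integral {0..1} (fx z0) = blinfun_inner_right (cnj (integral {0..1} (W z0)))"
  proof -
    have bl: "bounded_linear (\<lambda>w. blinfun_inner_right (cnj w) :: complex \<Rightarrow>\<^sub>L real)"
      by (intro bounded_linear_compose[OF bounded_linear_blinfun_inner_right] bounded_linear_cnj)
    have "W z0 integrable_on {0..1}"
      using contWz S by (auto intro: integrable_continuous_real)
    from integral_linear[OF this bl] show ?thesis
      by (simp add: o_def fx_def[abs_def])
  qed
  then have "blinfun_apply (integral {0..1} (fx z0)) = (\<lambda>v. Re (c z0 * v))"
    by (intro ext) (simp only: int_W inner_eq)
  with L show ?thesis
    unfolding at_within_open[OF S(4,1)] \<gamma>_def box_real by (simp only:)
qed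

text \<open>
  The recursion \<open>q\<^sub>n' = - H' q\<^sub>n\<^sub>-\<^sub>1\<close> says formally that \<open>exp (w H) \<Sum> q\<^sub>n w\<^sup>n\<close> has the derivative
  \<open>\<xi> exp (w H)\<close>. To avoid differentiating an infinite series, the coefficients \<open>P\<^sub>n\<close> of this product
  are identified as primitives of \<open>\<xi> H\<^sup>n / n!\<close>; the sum of \<open>P\<^sub>n w\<^sup>n\<close> is then an integral of an
  exponential series along a segment.
\<close>

lemma sums_of_iterated_primitives:
  fixes q :: "nat \<Rightarrow> complex \<Rightarrow> complex" and H H' \<xi> J :: "complex \<Rightarrow> complex"
  assumes S: "convex S" "w0 \<in> S" "z \<in> S"
    and H: "\<And>x. x \<in> S \<Longrightarrow> (H has_field_derivative H' x) (at x)"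
    and q0: "\<And>x. x \<in> S \<Longrightarrow> (q 0 has_field_derivative \<xi> x) (at x)"
    and qSuc: "\<And>n x. x \<in> S \<Longrightarrow> (q (Suc n) has_field_derivative - (H' x * q n x)) (at x)"
    and q_base: "\<And>n. q n w0 = 0"
    and \<xi>: "continuous_on S \<xi>"
    and J: "\<And>x. x \<in> S \<Longrightarrow> (J has_field_derivative \<xi> x * exp (H x * w)) (at x)" "J w0 = 0"
    and summ: "summable (\<lambda>n. norm (q n z * w ^ n))"
  shows "(\<lambda>n. q n z * w ^ n) sums (exp (- (H z * w)) * J z)"
proof -
  define P where "P n x = (\<Sum>i\<le>n. H x ^ i / fact i * q (n - i) x)" for n x
  have P_deriv: "(P n has_field_derivative \<xi> x * (H x ^ n / fact n)) (at x)" if x: "x \<in> S" for n x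
  proof -
    define A where "A i = H x ^ i / fact i" for i
    \<comment> \<open>derivatives of the exponential terms and of the iterated primitives; two telescoping sums remain\<close>
  define A' where "A' i = (case i of 0 \<Rightarrow> 0 | Suc k \<Rightarrow> H' x * A k)" for i
    define q' where "q' m = (case m of 0 \<Rightarrow> \<xi> x | Suc k \<Rightarrow> - (H' x * q k x))" for m
    have dA: "((\<lambda>x. H x ^ i / fact i) has_field_derivative A' i) (at x)" for i
    proof (cases i)
      case (Suc k)
      have "((\<lambda>x. H x ^ Suc k / fact (Suc k)) has_field_derivative (of_nat (Suc k) * (H' x * H x ^ k)) / fact (Suc k)) (at x)"
        by (auto intro!: derivative_eq_intros H x simp del: of_nat_Suc fact_Suc power_Suc)
      moreover have "(of_nat (Suc k) * (H' x * H x ^ k)) / fact (Suc k) = A' i"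
        by (simp add: Suc A'_def A_def del: of_nat_Suc)
      ultimately show ?thesis using Suc by (simp only:)
    qed (simp add: A'_def)
    have dq: "(q m has_field_derivative q' m) (at x)" for m
      using q0[OF x] qSuc[OF x] by (cases m) (auto simp: q'_def)
    have "(P n has_field_derivative (\<Sum>i\<le>n. A i * q' (n - i) + A' i * q (n - i) x)) (at x)"
      unfolding P_def[abs_def] A_def by (intro DERIV_sum DERIV_mult' dA dq)
    moreover have "(\<Sum>i\<le>n. A i * q' (n - i) + A' i * q (n - i) x) = \<xi> x * A n"
    proof (cases n)
      case (Suc m)
      have "(\<Sum>i\<le>n. A i * q' (n - i)) = (\<Sum>i\<le>m. A i * - (H' x * q (m - i) x)) + \<xi> x * A n"
        by (simp add: Suc q'_def Suc_diff_le)
      moreover have "(\<Sum>i\<le>n. A' i * q (n - i) x) = (\<Sum>i\<le>m. H' x * A i * q (m - i) x)"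
        unfolding Suc sum.atMost_Suc_shift by (simp add: A'_def)
      ultimately show ?thesis
        by (simp add: sum.distrib sum_negf mult_ac)
    qed (simp add: A'_def q'_def)
    ultimately show ?thesis by (simp add: A_def)
  qed
  define \<gamma> where "\<gamma> t = w0 + of_real t * (z - w0)" for t :: real
  have \<gamma>S: "\<gamma> t \<in> S" if "t \<in> {0..1}" for t
    using convex_radial_mem[OF S that] by (simp add: \<gamma>_def)
  have cont\<gamma>: "continuous_on {0..1} \<gamma>"
    unfolding \<gamma>_def by (intro continuous_intros)
  have ftc: "((\<lambda>t. g (\<gamma> t) * (z - w0)) has_integral G z - G w0) {0..1}"
    if G: "\<And>x. x \<in> S \<Longrightarrow> (G has_field_derivative g x) (at x)" for G g
  proof -
    have eq: "\<gamma> = linepath w0 z"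
      by (simp add: fun_eq_iff \<gamma>_def linepath_def scaleR_conv_of_real algebra_simps)
    have "(g has_contour_integral (G (pathfinish (linepath w0 z)) - G (pathstart (linepath w0 z)))) (linepath w0 z)"
      by (rule contour_integral_primitive[where S = S])
        (use G S in \<open>auto intro: has_field_derivative_at_within simp: closed_segment_subset\<close>)
    then show ?thesis unfolding has_contour_integral_linepath eq by simp
  qed
  have "continuous_on S H"
    by (intro continuous_at_imp_continuous_on ballI) (rule DERIV_isCont[OF H])
  then have cH: "continuous_on {0..1} (\<lambda>t. H (\<gamma> t))"
    by (rule continuous_on_compose2[OF _ cont\<gamma>]) (use \<gamma>S in auto)
  have c\<xi>: "continuous_on {0..1} (\<lambda>t. \<xi> (\<gamma> t))"
    by (rule continuous_on_compose2[OF \<xi> cont\<gamma>]) (use \<gamma>S in auto)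
  obtain R where R: "R \<ge> 0" "\<And>t. t \<in> {0..1} \<Longrightarrow> norm (H (\<gamma> t)) \<le> R"
    using continuous_on_bounded_unit[OF cH] by blast
  obtain B where B: "B \<ge> 0" "\<And>t. t \<in> {0..1} \<Longrightarrow> norm (\<xi> (\<gamma> t)) \<le> B"
    using continuous_on_bounded_unit[OF c\<xi>] by blast
  define T where "T n t = \<xi> (\<gamma> t) * (H (\<gamma> t) ^ n / fact n) * (z - w0) * w ^ n" for n t
  have intT: "integral {0..1} (T n) = P n z * w ^ n" for n
  proof -
    have "P n w0 = 0" by (simp add: P_def q_base)
    then have "(T n has_integral P n z * w ^ n) {0..1}"
      using has_integral_mult_left[OF ftc[OF P_deriv[of _ n]], of "w ^ n"]
      by (simp add: T_def[abs_def])
    then show ?thesis by (rule integral_unique)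
  qed
  have "((\<lambda>n. integral {0..1} (T n)) has_sum integral {0..1} (\<lambda>t. \<xi> (\<gamma> t) * exp (H (\<gamma> t) * w) * (z - w0))) UNIV"
  proof (rule has_sum_integral)
    show "continuous_on {0..1} (T n)" for n
      unfolding T_def by (intro continuous_on_mult continuous_on_divide continuous_on_power
          continuous_on_const c\<xi> cH) auto
    have "(\<lambda>n. norm ((of_real (R * norm w) :: complex) ^ n / fact n) * (B * norm (z - w0))) summable_on UNIV"
      by (intro summable_on_cmult_left exp_powers_sum(1))
    then show "(\<lambda>n. (R * norm w) ^ n / fact n * (B * norm (z - w0))) summable_on UNIV"
      using R by (simp add: norm_divide norm_power norm_mult)
    fix n t assume t: "t \<in> {0..1::real}"
    have "norm (T n t) = norm (\<xi> (\<gamma> t)) * (norm (H (\<gamma> t)) ^ n / fact n) * norm (z - w0) * norm w ^ n"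
      by (simp add: T_def norm_mult norm_divide norm_power)
    also have "\<dots> \<le> B * (R ^ n / fact n) * norm (z - w0) * norm w ^ n"
      using R(1) B(1) R(2)[OF t] B(2)[OF t]
      by (intro mult_right_mono mult_mono divide_right_mono power_mono) auto
    finally show "norm (T n t) \<le> (R * norm w) ^ n / fact n * (B * norm (z - w0))"
      by (simp add: power_mult_distrib mult_ac)
  next
    fix t
    have "((\<lambda>n. \<xi> (\<gamma> t) * (z - w0) * ((H (\<gamma> t) * w) ^ n / fact n)) has_sum \<xi> (\<gamma> t) * (z - w0) * exp (H (\<gamma> t) * w)) UNIV"
      by (intro has_sum_cmult_right exp_powers_sum)
    then show "((\<lambda>n. T n t) has_sum \<xi> (\<gamma> t) * exp (H (\<gamma> t) * w) * (z - w0)) UNIV"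
      by (simp add: T_def power_mult_distrib mult_ac)
  qed
  moreover have "integral {0..1} (\<lambda>t. \<xi> (\<gamma> t) * exp (H (\<gamma> t) * w) * (z - w0)) = J z"
    using integral_unique[OF ftc[OF J(1)]] J(2) by simp
  ultimately have "((\<lambda>n. P n z * w ^ n) has_sum J z) UNIV"
    by (simp add: intT)
  then have sumP: "(\<lambda>n. P n z * w ^ n) sums J z"
    by (rule has_sum_imp_sums)
  define a where "a n = (H z * w) ^ n / fact n" for n
  have a: "a sums exp (H z * w)" "summable (\<lambda>n. norm (a n))"
    using exp_powers_sum[of "H z * w"] unfolding a_def
    by (auto intro: has_sum_imp_sums simp: summable_on_UNIV_nonneg_real_iff)
  have "(\<lambda>n. \<Sum>i\<le>n. a i * (q (n - i) z * w ^ (n - i))) sums ((\<Sum>n. a n) * (\<Sum>n. q n z * w ^ n))"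
    by (rule Cauchy_product_sums[OF a(2) summ])
  moreover have "(\<Sum>i\<le>n. a i * (q (n - i) z * w ^ (n - i))) = P n z * w ^ n" for n
  proof -
    have "a i * (q (n - i) z * w ^ (n - i)) = H z ^ i / fact i * q (n - i) z * w ^ n" if "i \<le> n" for i
    proof -
      have "w ^ n = w ^ i * w ^ (n - i)" using that by (simp add: power_add[symmetric])
      then show ?thesis by (simp add: a_def power_mult_distrib)
    qed
    then show ?thesis unfolding P_def sum_distrib_right by (intro sum.cong) auto
  qed
  ultimately have "(\<lambda>n. P n z * w ^ n) sums (exp (H z * w) * (\<Sum>n. q n z * w ^ n))"
    using a(1) by (simp add: sums_iff)
  with sumP have "J z = exp (H z * w) * (\<Sum>n. q n z * w ^ n)"
    by (rule sums_unique2)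
  then have "exp (- (H z * w)) * J z = (\<Sum>n. q n z * w ^ n)"
    by (simp add: exp_minus)
  with summ show ?thesis
    by (simp add: summable_norm_cancel summable_sums)
qed

section \<open>Real solutions of the Klein-Gordon equation\<close>

text \<open>
  The equation \<open>\<Delta> u = 4 \<mu>\<^sup>2 |h'|\<^sup>2 u\<close> in first order form: \<open>p\<close> is \<open>\<partial>u/\<partial>z\<close>, and the derivative of \<open>p\<close> is
  split into its \<open>z\<close>-part \<open>r\<close> and its \<open>cnj z\<close>-part, which is a quarter of the Laplacian. In this form
  the equation can be pulled back along holomorphic maps by the chain rule alone.
\<close>

locale klein_gordon =
  fixes S :: "complex set" and w0 :: complex and \<mu> :: real and h h' h'' p r :: "complex \<Rightarrow> complex"
    and u :: "complex \<Rightarrow> real"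
  assumes domain: "open S" "w0 \<in> S"
    and h_deriv: "\<And>z. z \<in> S \<Longrightarrow> (h has_field_derivative h' z) (at z)"
    and h'_deriv: "\<And>z. z \<in> S \<Longrightarrow> (h' has_field_derivative h'' z) (at z)"
    and h_base: "h w0 = 0"
    and u_deriv: "\<And>z. z \<in> S \<Longrightarrow> (u has_derivative (\<lambda>v. 2 * Re (p z * v))) (at z)"
    and p_deriv: "\<And>z. z \<in> S \<Longrightarrow>
      (p has_derivative (\<lambda>v. r z * v + of_real (\<mu>\<^sup>2 * (norm (h' z))\<^sup>2 * u z) * cnj v)) (at z)"
    and cont: "continuous_on S r" "continuous_on S h''"
    and u_base: "u w0 = 0"
begin

lemma continuous:
  "continuous_on S h" "continuous_on S h'" "continuous_on S p" "continuous_on S u"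
proof -
  show "continuous_on S h"
    by (intro continuous_at_imp_continuous_on ballI) (rule DERIV_isCont[OF h_deriv])
  show "continuous_on S h'"
    by (intro continuous_at_imp_continuous_on ballI) (rule DERIV_isCont[OF h'_deriv])
  show "continuous_on S p"
    by (intro continuous_at_imp_continuous_on ballI) (rule has_derivative_continuous[OF p_deriv])
  show "continuous_on S u"
    by (intro continuous_at_imp_continuous_on ballI) (rule has_derivative_continuous[OF u_deriv])
qed

lemma pullback:
  assumes T: "open T" "t0 \<in> T" and \<psi>: "\<psi> holomorphic_on T" "\<psi> ` T \<subseteq> S" "\<psi> t0 = w0"
  shows "klein_gordon T t0 \<mu> (\<lambda>t. h (\<psi> t)) (\<lambda>t. h' (\<psi> t) * deriv \<psi> t)
    (\<lambda>t. h'' (\<psi> t) * deriv \<psi> t * deriv \<psi> t + h' (\<psi> t) * deriv (deriv \<psi>) t)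
    (\<lambda>t. p (\<psi> t) * deriv \<psi> t)
    (\<lambda>t. r (\<psi> t) * deriv \<psi> t * deriv \<psi> t + p (\<psi> t) * deriv (deriv \<psi>) t)
    (\<lambda>t. u (\<psi> t))"
proof
  show "open T" "t0 \<in> T" by fact+
  have h2: "deriv \<psi> holomorphic_on T" "deriv (deriv \<psi>) holomorphic_on T"
    using \<psi> T by (auto intro!: holomorphic_deriv)
  have c\<psi>: "continuous_on T \<psi>" "continuous_on T (deriv \<psi>)" "continuous_on T (deriv (deriv \<psi>))"
    using \<psi> h2 by (auto intro: holomorphic_on_imp_continuous_on)
  note c = continuous[THEN continuous_on_compose2, OF c\<psi>(1) \<psi>(2)] cont[THEN continuous_on_compose2, OF c\<psi>(1) \<psi>(2)]
  show "continuous_on T (\<lambda>t. r (\<psi> t) * deriv \<psi> t * deriv \<psi> t + p (\<psi> t) * deriv (deriv \<psi>) t)"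
    "continuous_on T (\<lambda>t. h'' (\<psi> t) * deriv \<psi> t * deriv \<psi> t + h' (\<psi> t) * deriv (deriv \<psi>) t)"
    by (intro continuous_on_add continuous_on_mult c c\<psi>)+
  show "h (\<psi> t0) = 0" "u (\<psi> t0) = 0" by (simp_all add: \<psi> h_base u_base)
  fix t assume t: "t \<in> T"
  then have \<psi>S: "\<psi> t \<in> S" using \<psi> by auto
  have d: "(\<psi> has_field_derivative deriv \<psi> t) (at t)" "(deriv \<psi> has_field_derivative deriv (deriv \<psi>) t) (at t)"
    using holomorphic_derivI[OF \<psi>(1) T(1) t] holomorphic_derivI[OF h2(1) T(1) t] by auto
  show "((\<lambda>t. h (\<psi> t)) has_field_derivative h' (\<psi> t) * deriv \<psi> t) (at t)"
    by (rule DERIV_chain2[OF h_deriv[OF \<psi>S] d(1)])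
  show "((\<lambda>t. h' (\<psi> t) * deriv \<psi> t) has_field_derivative
      h'' (\<psi> t) * deriv \<psi> t * deriv \<psi> t + h' (\<psi> t) * deriv (deriv \<psi>) t) (at t)"
    using DERIV_mult[OF DERIV_chain2[OF h'_deriv[OF \<psi>S] d(1)] d(2)] by (simp add: algebra_simps)
  have D: "(\<psi> has_derivative (\<lambda>v. deriv \<psi> t * v)) (at t)" "(deriv \<psi> has_derivative (\<lambda>v. deriv (deriv \<psi>) t * v)) (at t)"
    using d by (simp_all add: has_field_derivative_def)
  show "((\<lambda>t. u (\<psi> t)) has_derivative (\<lambda>v. 2 * Re (p (\<psi> t) * deriv \<psi> t * v))) (at t)"
    using has_derivative_compose[OF D(1) u_deriv[OF \<psi>S]] by (simp add: mult.assoc)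
  have nn: "(norm (h' (\<psi> t) * deriv \<psi> t))\<^sup>2 = (norm (h' (\<psi> t)))\<^sup>2 * (norm (deriv \<psi> t))\<^sup>2"
    by (simp add: norm_mult power_mult_distrib)
  have "((\<lambda>t. p (\<psi> t) * deriv \<psi> t) has_derivative (\<lambda>v. p (\<psi> t) * (deriv (deriv \<psi>) t * v)
     + (r (\<psi> t) * (deriv \<psi> t * v) + of_real (\<mu>\<^sup>2 * (norm (h' (\<psi> t)))\<^sup>2 * u (\<psi> t)) * cnj (deriv \<psi> t * v)) * deriv \<psi> t)) (at t)"
    by (rule has_derivative_mult[OF has_derivative_compose[OF D(1) p_deriv[OF \<psi>S]] D(2)])
  moreover have "p (\<psi> t) * (deriv (deriv \<psi>) t * v)
     + (r (\<psi> t) * (deriv \<psi> t * v) + of_real (\<mu>\<^sup>2 * (norm (h' (\<psi> t)))\<^sup>2 * u (\<psi> t)) * cnj (deriv \<psi> t * v)) * deriv \<psi> t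
     = (r (\<psi> t) * deriv \<psi> t * deriv \<psi> t + p (\<psi> t) * deriv (deriv \<psi>) t) * v +
       of_real (\<mu>\<^sup>2 * (norm (h' (\<psi> t) * deriv \<psi> t))\<^sup>2 * u (\<psi> t)) * cnj v" for v
    unfolding nn of_real_mult complex_norm_square by (simp add: algebra_simps)
  ultimately show "((\<lambda>t. p (\<psi> t) * deriv \<psi> t) has_derivative (\<lambda>v.
       (r (\<psi> t) * deriv \<psi> t * deriv \<psi> t + p (\<psi> t) * deriv (deriv \<psi>) t) * v +
       of_real (\<mu>\<^sup>2 * (norm (h' (\<psi> t) * deriv \<psi> t))\<^sup>2 * u (\<psi> t)) * cnj v)) (at t)"
    by simp
qed

end

locale klein_gordon_convex = klein_gordon +
  assumes convex_domain: "convex S"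
begin

lemmas S = domain(1) convex_domain domain(2)

text \<open>
  For a spectral parameter \<open>l\<close> on the unit circle \<open>weight l\<close> is \<open>exp E\<close> and \<open>cnj l\<close> is the inverse of
  \<open>l\<close>. Written with \<open>cnj l\<close>, the weight is real for every \<open>l\<close>.
\<close>

definition weight :: "complex \<Rightarrow> complex \<Rightarrow> complex" where
  "weight l z = exp (of_real \<mu> * (cnj l * h z + l * cnj (h z)))"

definition form_coeff :: "complex \<Rightarrow> complex \<Rightarrow> complex" where
  "form_coeff l z = - weight l z * (cnj l * p z + of_real \<mu> * h' z * of_real (u z))"

text \<open>
  The primitive of \<open>Re (form_coeff l dz)\<close> that vanishes at the base point.
\<close>

definition loop_primitive :: "complex \<Rightarrow> complex \<Rightarrow> real" where
  "loop_primitive l z = integral {0..1} (\<lambda>t. Re (form_coeff l (w0 + of_real t * (z - w0)) * (z - w0)))"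

lemma weight_real: "weight l z = of_real (exp (2 * \<mu> * Re (cnj l * h z)))"
proof -
  have "of_real \<mu> * (cnj l * h z + l * cnj (h z)) = of_real (2 * \<mu> * Re (cnj l * h z))"
    by (simp add: complex_eq_iff algebra_simps)
  then show ?thesis unfolding weight_def by (simp only: exp_of_real)
qed

lemma weight_deriv:
  assumes "z \<in> S"
  shows "(weight l has_derivative (\<lambda>v. weight l z * of_real \<mu> * (cnj l * h' z * v + l * cnj (h' z) * cnj v))) (at z)"
proof -
  have dh: "(h has_derivative (\<lambda>v. h' z * v)) (at z)"
    using h_deriv[OF assms] by (simp add: has_field_derivative_def)
  have "((\<lambda>z. of_real \<mu> * (cnj l * h z + l * cnj (h z))) has_derivative
      (\<lambda>v. of_real \<mu> * (cnj l * (h' z * v) + l * cnj (h' z * v)))) (at z)"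
    by (intro has_derivative_mult_right has_derivative_add has_derivative_cnj dh)
  from has_derivative_exp_complex[OF this] show ?thesis
    by (simp add: weight_def[abs_def] mult_ac)
qed

text \<open>
  The forms are closed: in the derivative of \<open>form_coeff l\<close> the coefficient of \<open>cnj v\<close> is the weight
  times \<open>- \<mu> (cnj h' p + h' cnj p) - \<mu>\<^sup>2 |h'|\<^sup>2 u (l + cnj l)\<close>, which is real. The last term combines a
  product of first derivatives with the equation for \<open>u\<close>; this is where the equation enters.
\<close>

lemma loop_primitive_deriv:
  assumes l: "norm l = 1" and z: "z \<in> S"
  shows "(loop_primitive l has_derivative (\<lambda>v. Re (form_coeff l z * v))) (at z)"
proof -
  define \<alpha> where "\<alpha> z = - weight l z * (of_real \<mu> * cnj l * h' z * (cnj l * p z + of_real \<mu> * h' z * of_real (u z))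
      + cnj l * r z + of_real \<mu> * h'' z * of_real (u z) + of_real \<mu> * h' z * p z)" for z
  define \<beta> where "\<beta> z = - exp (2 * \<mu> * Re (cnj l * h z)) * (2 * \<mu> * Re (cnj (h' z) * p z)
      + 2 * \<mu>\<^sup>2 * (norm (h' z))\<^sup>2 * u z * Re l)" for z
  show ?thesis
    unfolding loop_primitive_def[abs_def]
  proof (rule radial_primitive[OF S z, where \<alpha> = \<alpha> and \<beta> = \<beta>])
    fix z assume z: "z \<in> S"
    have dh': "(h' has_derivative (\<lambda>v. h'' z * v)) (at z)"
      using h'_deriv[OF z] by (simp add: has_field_derivative_def)
    have ll: "l * cnj l = 1" using l by (simp add: complex_norm_square[symmetric])
    have nn: "complex_of_real ((norm (h' z))\<^sup>2) = h' z * cnj (h' z)"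
      by (rule complex_norm_square)
    have b: "of_real (\<beta> z) = - weight l z * (of_real \<mu> * (cnj (h' z) * p z + h' z * cnj (p z))
       + of_real (\<mu>\<^sup>2) * (h' z * cnj (h' z)) * of_real (u z) * (l + cnj l))"
    proof -
      have 1: "cnj (h' z) * p z + h' z * cnj (p z) = of_real (2 * Re (cnj (h' z) * p z))"
        by (simp add: complex_eq_iff algebra_simps)
      have 2: "l + cnj l = of_real (2 * Re l)" by (simp add: complex_eq_iff)
      show ?thesis unfolding 1 2 \<beta>_def weight_real nn[symmetric]
        by (simp add: algebra_simps)
    qed
    have u2: "of_real (2 * Re x) = x + cnj x" for x :: complex
      by (simp add: complex_eq_iff)
    have "(form_coeff l has_derivative (\<lambda>v.
        - (weight l z * of_real \<mu> * (cnj l * h' z * v + l * cnj (h' z) * cnj v)) * (cnj l * p z + of_real \<mu> * h' z * of_real (u z))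
        - weight l z * (cnj l * (r z * v + of_real (\<mu>\<^sup>2 * (norm (h' z))\<^sup>2 * u z) * cnj v)
           + of_real \<mu> * (h' z * of_real (2 * Re (p z * v)) + h'' z * v * of_real (u z))))) (at z)"
    proof -
      have "((\<lambda>z. - weight l z * (cnj l * p z + of_real \<mu> * h' z * of_real (u z))) has_derivative (\<lambda>v.
        - weight l z * (cnj l * (r z * v + of_real (\<mu>\<^sup>2 * (norm (h' z))\<^sup>2 * u z) * cnj v)
           + (of_real \<mu> * h' z * of_real (2 * Re (p z * v)) + of_real \<mu> * (h'' z * v) * of_real (u z)))
        + - (weight l z * of_real \<mu> * (cnj l * h' z * v + l * cnj (h' z) * cnj v)) * (cnj l * p z + of_real \<mu> * h' z * of_real (u z))))
        (at z)"
        by (intro has_derivative_mult has_derivative_add has_derivative_minus has_derivative_mult_right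
            has_derivative_of_real weight_deriv p_deriv u_deriv dh' z)
      then show ?thesis
        unfolding form_coeff_def[abs_def]
        by (rule has_derivative_eq_rhs) (simp add: fun_eq_iff algebra_simps)
    qed
    moreover have "- (weight l z * of_real \<mu> * (cnj l * h' z * v + l * cnj (h' z) * cnj v)) * (cnj l * p z + of_real \<mu> * h' z * of_real (u z))
        - weight l z * (cnj l * (r z * v + of_real (\<mu>\<^sup>2 * (norm (h' z))\<^sup>2 * u z) * cnj v)
           + of_real \<mu> * (h' z * of_real (2 * Re (p z * v)) + h'' z * v * of_real (u z)))
        = \<alpha> z * v + of_real (\<beta> z) * cnj v" for v
    proof -
      have "l * (cnj l * x) = x" for x using ll by (simp add: mult.assoc[symmetric])
      then show ?thesis
        unfolding b u2 of_real_mult[of _ "u z"] of_real_mult[of "\<mu>\<^sup>2"] nn \<alpha>_def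
        by (simp add: algebra_simps power2_eq_square)
    qed
    ultimately show "(form_coeff l has_derivative (\<lambda>v. \<alpha> z * v + of_real (\<beta> z) * cnj v)) (at z)"
      by simp
  next
    show "continuous_on S \<alpha>" "continuous_on S \<beta>"
      unfolding \<alpha>_def[abs_def] \<beta>_def[abs_def] weight_def
      by (intro continuous_intros continuous cont)+
  qed
qed

lemma loop_primitive_base: "loop_primitive l w0 = 0"
  by (simp add: loop_primitive_def)

text \<open>
  For \<open>l = 1\<close> and \<open>l = - 1\<close> the form is \<open>- l/2\<close> times the differential of \<open>weight l * u\<close>.
\<close>

lemma loop_primitive_at_units:
  assumes z: "z \<in> S"
  shows "loop_primitive 1 z = - exp (2 * \<mu> * Re (h z)) * u z / 2" "loop_primitive (-1) z = exp (- (2 * \<mu> * Re (h z))) * u z / 2"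
proof -
  have *: "loop_primitive l z = - Re l * exp (2 * \<mu> * Re (l * h z)) * u z / 2" if l: "l = 1 \<or> l = -1" for l
  proof -
    have "(\<lambda>x. loop_primitive l x + Re l * exp (2 * \<mu> * Re (l * h x)) * u x / 2) z
       = (\<lambda>x. loop_primitive l x + Re l * exp (2 * \<mu> * Re (l * h x)) * u x / 2) w0"
    proof (rule has_derivative_zero_unique[OF S(2) _ z S(3)])
      fix x assume x: "x \<in> S"
      have dh: "(h has_derivative (\<lambda>v. h' x * v)) (at x)"
        using h_deriv[OF x] by (simp add: has_field_derivative_def)
      have "((\<lambda>x. loop_primitive l x + Re l * exp (2 * \<mu> * Re (l * h x)) * u x / 2) has_derivative
         (\<lambda>v. Re (form_coeff l x * v) + Re l * (exp (2 * \<mu> * Re (l * h x)) * (2 * Re (p x * v))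
             + exp (2 * \<mu> * Re (l * h x)) * (2 * \<mu> * Re (l * (h' x * v))) * u x) / 2)) (at x)"
        using l by (auto intro!: derivative_eq_intros loop_primitive_deriv u_deriv x dh)
      moreover have "Re (form_coeff l x * v) + Re l * (exp (2 * \<mu> * Re (l * h x)) * (2 * Re (p x * v))
             + exp (2 * \<mu> * Re (l * h x)) * (2 * \<mu> * Re (l * (h' x * v))) * u x) / 2 = 0" for v
        using l unfolding form_coeff_def weight_real by (auto simp: field_simps)
      ultimately show "((\<lambda>x. loop_primitive l x + Re l * exp (2 * \<mu> * Re (l * h x)) * u x / 2) has_derivative (\<lambda>v. 0)) (at x within S)"
        by (auto intro: has_derivative_at_withinI)
    qed
    then show ?thesis by (simp add: loop_primitive_base u_base)
  qed
  show "loop_primitive 1 z = - exp (2 * \<mu> * Re (h z)) * u z / 2" "loop_primitive (-1) z = exp (- (2 * \<mu> * Re (h z))) * u z / 2"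
    using *[of 1] *[of "-1"] by auto
qed

lemma loop_primitive_continuous: "continuous_on (S \<times> {0..2*pi}) (\<lambda>(z, \<theta>). loop_primitive (cis \<theta>) z)"
proof -
  define m where "m x = w0 + of_real (snd x) * (fst (fst x) - w0)" for x :: "(complex \<times> real) \<times> real"
  have m: "continuous_on ((S \<times> {0..2*pi}) \<times> {0..1}) m"
    unfolding m_def by (intro continuous_intros)
  have mS: "m ` ((S \<times> {0..2*pi}) \<times> {0..1}) \<subseteq> S"
    using convex_radial_mem[OF S(2,3)] by (auto simp: m_def)
  note c = continuous[THEN continuous_on_compose2, OF m mS]
  have "continuous_on ((S \<times> {0..2*pi}) \<times> cbox 0 1)
      (\<lambda>(x, t). Re (form_coeff (cis (snd x)) (m (x, t)) * (fst x - w0)))"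
    unfolding form_coeff_def weight_def case_prod_unfold box_real prod.collapse
    by (intro continuous_intros c)
  then have "continuous_on ((S \<times> {0..2*pi}) \<times> cbox 0 1)
      (\<lambda>(x, t). Re (form_coeff (cis (snd x)) (w0 + of_real t * (fst x - w0)) * (fst x - w0)))"
    by (simp add: m_def)
  from integral_continuous_on_param[OF this] show ?thesis
    by (simp add: loop_primitive_def case_prod_unfold)
qed

text \<open>
  By its definition the primitive is an integral of the weight times a real Laurent polynomial
  \<open>A cnj l + B + l cnj A\<close>, hence a sum of three loops with known expansions.
\<close>

lemma loop_primitive_wiener:
  assumes z: "z \<in> S"
  obtains c where "wiener_loop (\<lambda>l. of_real (loop_primitive l z)) c"
proof -
  define \<gamma> where "\<gamma> t = w0 + of_real t * (z - w0)" for t :: real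
  have \<gamma>S: "\<gamma> ` {0..1} \<subseteq> S"
    using convex_radial_mem[OF S(2,3) z] by (auto simp: \<gamma>_def)
  have cont\<gamma>: "continuous_on {0..1} \<gamma>"
    unfolding \<gamma>_def by (intro continuous_intros)
  note c = continuous[THEN continuous_on_compose2, OF cont\<gamma> \<gamma>S]
  define d where "d = z - w0"
  define H where "H t = of_real \<mu> * h (\<gamma> t)" for t
  define A where "A t = p (\<gamma> t) * d" for t
  define B :: "real \<Rightarrow> complex" where "B t = of_real (2 * \<mu> * u (\<gamma> t) * Re (h' (\<gamma> t) * d))" for t
  have cH: "continuous_on {0..1} H" unfolding H_def by (intro continuous_on_mult continuous_on_const c)
  have cA: "continuous_on {0..1} A" unfolding A_def by (intro continuous_on_mult continuous_on_const c)
  have cB: "continuous_on {0..1} (\<lambda>t. B t :: complex)"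
    unfolding B_def by (intro continuous_on_of_real continuous_on_mult continuous_on_const continuous_on_Re c)
  have cA': "continuous_on {0..1} (\<lambda>t. cnj (A t))" by (intro continuous_on_cnj cA)
  define W where "W l t = exp (cnj (H t) * l + H t * cnj l)" for l t
  have cW: "continuous_on {0..1} (W l)" for l
    unfolding W_def by (intro continuous_on_exp continuous_on_mult continuous_on_add continuous_on_const continuous_on_cnj cH)
  obtain a where a: "wiener_loop (\<lambda>l. integral {0..1} (\<lambda>t. W l t * A t)) a"
    using wiener_loop_exp_integral[OF cH cA] unfolding W_def by blast
  obtain b where b: "wiener_loop (\<lambda>l. integral {0..1} (\<lambda>t. W l t * B t)) b"
    using wiener_loop_exp_integral[OF cH cB] unfolding W_def by blast
  obtain a' where a': "wiener_loop (\<lambda>l. integral {0..1} (\<lambda>t. W l t * cnj (A t))) a'"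
    using wiener_loop_exp_integral[OF cH cA'] unfolding W_def by blast
  have "wiener_loop (\<lambda>l. (- 1 / 2) * (l powi (- 1) * integral {0..1} (\<lambda>t. W l t * A t)
      + (integral {0..1} (\<lambda>t. W l t * B t) + l powi 1 * integral {0..1} (\<lambda>t. W l t * cnj (A t)))))
      (\<lambda>j. (- 1 / 2) * (a (j - - 1) + (b j + a' (j - 1))))"
    by (intro wiener_loop_cmult wiener_loop_add wiener_loop_shift a b a')
  moreover have "(- 1 / 2) * (l powi (- 1) * integral {0..1} (\<lambda>t. W l t * A t)
      + (integral {0..1} (\<lambda>t. W l t * B t) + l powi 1 * integral {0..1} (\<lambda>t. W l t * cnj (A t))))
      = of_real (loop_primitive l z)" if l: "norm l = 1" for l
  proof -
    have int: "(\<lambda>t. W l t * f t) integrable_on {0..1}" if "continuous_on {0..1} f" for f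
      by (intro integrable_continuous_real continuous_on_mult cW that)
    have W: "W l t = weight l (\<gamma> t)" for t
      by (simp add: W_def weight_def H_def algebra_simps)
    have form_coeff: "of_real (Re (form_coeff l (\<gamma> t) * d)) =
        (- 1 / 2) * (cnj l * (W l t * A t) + (W l t * B t + l * (W l t * cnj (A t))))" for t
    proof -
      have 2: "of_real (Re x) = (x + cnj x) / 2" for x :: complex by (simp add: complex_eq_iff)
      have 3: "of_real (2 * \<mu> * v * Re x) = of_real (\<mu> * v) * (x + cnj x)" for v and x :: complex
        by (simp add: complex_eq_iff)
      have "cnj (weight l (\<gamma> t)) = weight l (\<gamma> t)" by (simp add: weight_real)
      then show ?thesis unfolding 2 W form_coeff_def A_def B_def 3 by (simp add: field_simps)
    qed
    have 1: "complex_of_real (loop_primitive l z) = integral {0..1} (\<lambda>t. of_real (Re (form_coeff l (\<gamma> t) * d)))"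
    proof -
      have "continuous_on {0..1} (\<lambda>t. Re (form_coeff l (\<gamma> t) * d))"
        unfolding form_coeff_def weight_def by (intro continuous_intros c)
      from integral_linear[OF integrable_continuous_real[OF this] bounded_linear_of_real]
      show ?thesis unfolding o_def loop_primitive_def \<gamma>_def d_def by (rule sym)
    qed
    have i: "l powi (- 1) = cnj l" using cnj_circle[OF l] by (simp add: power_int_minus)
    show ?thesis
      unfolding 1 form_coeff i power_int_1_right
      by (rule integral_unique[symmetric])
        (intro has_integral_mult_right has_integral_add integrable_integral int cA cB cA')
  qed
  ultimately have "wiener_loop (\<lambda>l. of_real (loop_primitive l z)) (\<lambda>j. (- 1 / 2) * (a (j - - 1) + (b j + a' (j - 1))))"
    by (rule wiener_loop_cong)
  then show thesis by (rule that)
qed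

text \<open>
  Only the factor \<open>exp (\<mu> cnj l h)\<close> of the weight is divided out. The result is the loop
  \<open>exp (- E) K\<close> multiplied by \<open>exp (\<mu> l cnj h)\<close>, a power series in \<open>l\<close>. This confines the derivative with respect to \<open>cnj z\<close> to nonnegative powers of \<open>l\<close>.
\<close>

definition shifted_loop :: "complex \<Rightarrow> complex \<Rightarrow> complex" where
  "shifted_loop l z = exp (- (of_real \<mu> * h z) * cnj l) * of_real (loop_primitive l z)"

definition mode :: "int \<Rightarrow> complex \<Rightarrow> complex" where
  "mode j z = fourier_coeff (\<lambda>l. shifted_loop l z) j"

lemma shifted_loop_wiener:
  assumes z: "z \<in> S"
  shows "wiener_loop (\<lambda>l. shifted_loop l z) (\<lambda>j. mode j z)"
proof -
  obtain a b where "wiener_loop (\<lambda>l. of_real (loop_primitive l z)) a"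
      "wiener_loop (\<lambda>l. exp (- (of_real \<mu> * h z) * cnj l)) b"
    using loop_primitive_wiener[OF z] wiener_loop_exp_cnj[of "- (of_real \<mu> * h z)"] by metis
  from wiener_loop_mult[OF this(2,1)] obtain c where c: "wiener_loop (\<lambda>l. shifted_loop l z) c"
    unfolding shifted_loop_def by blast
  have "mode j z = c j" for j
    unfolding mode_def by (rule wiener_loop_coeff[OF c])
  with c show ?thesis by (simp add: fun_eq_iff)
qed


lemma shifted_loop_deriv:
  assumes l: "norm l = 1" and z: "z \<in> S"
  defines "e \<equiv> exp (of_real \<mu> * cnj (h z) * l)"
  shows "(shifted_loop l has_derivative (\<lambda>v.
     (- (of_real \<mu> * h' z) * (cnj l * shifted_loop l z) - 1 / 2 * (p z * (cnj l * e) + of_real \<mu> * h' z * of_real (u z) * e)) * v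
     + (- 1 / 2 * (cnj (p z) * (l * e) + of_real \<mu> * cnj (h' z) * of_real (u z) * e)) * cnj v)) (at z)"
proof -
  define b where "b = exp (- (of_real \<mu> * h z) * cnj l)"
  have dh: "(h has_derivative (\<lambda>v. h' z * v)) (at z)"
    using h_deriv[OF z] by (simp add: has_field_derivative_def)
  have "((\<lambda>z. - (of_real \<mu> * h z) * cnj l) has_derivative (\<lambda>v. - (of_real \<mu> * (h' z * v)) * cnj l)) (at z)"
    by (intro has_derivative_mult_left has_derivative_minus has_derivative_mult_right dh)
  from has_derivative_mult[OF has_derivative_exp_complex[OF this] has_derivative_of_real[OF loop_primitive_deriv[OF l z]]]
  have "(shifted_loop l has_derivative (\<lambda>v. b * of_real (Re (form_coeff l z * v))
      + b * (- (of_real \<mu> * (h' z * v)) * cnj l) * of_real (loop_primitive l z))) (at z)"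
    unfolding shifted_loop_def[abs_def] b_def .
  moreover have "b * of_real (Re (form_coeff l z * v))
      + b * (- (of_real \<mu> * (h' z * v)) * cnj l) * of_real (loop_primitive l z) =
     (- (of_real \<mu> * h' z) * (cnj l * shifted_loop l z) - 1 / 2 * (p z * (cnj l * e) + of_real \<mu> * h' z * of_real (u z) * e)) * v
     + (- 1 / 2 * (cnj (p z) * (l * e) + of_real \<mu> * cnj (h' z) * of_real (u z) * e)) * cnj v" for v
  proof -
    have be: "b * weight l z = e"
      unfolding b_def weight_def e_def exp_add[symmetric] by (simp add: algebra_simps)
    have 2: "of_real (Re x) = (x + cnj x) / 2" for x :: complex by (simp add: complex_eq_iff)
    have "cnj (weight l z) = weight l z" by (simp add: weight_real)
    then have E: "b * of_real (Re (form_coeff l z * v)) =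
       - 1 / 2 * ((b * weight l z) * (cnj l * p z + of_real \<mu> * h' z * of_real (u z)) * v
         + (b * weight l z) * (l * cnj (p z) + of_real \<mu> * cnj (h' z) * of_real (u z)) * cnj v)"
      unfolding 2 form_coeff_def by (simp add: field_simps)
    have k: "shifted_loop l z = b * of_real (loop_primitive l z)" by (simp add: shifted_loop_def b_def)
    show ?thesis
      unfolding E be k by (simp add: field_simps)
  qed
  ultimately show ?thesis by simp
qed

lemma shifted_loop_continuous: "continuous_on (S \<times> {0..2*pi}) (\<lambda>(z, \<theta>). shifted_loop (cis \<theta>) z)"
proof -
  have "continuous_on (S \<times> {0..2*pi}) (\<lambda>x. h (fst x))"
    by (rule continuous_on_compose2[OF continuous(1) continuous_on_fst[OF continuous_on_id]]) auto
  with loop_primitive_continuous show ?thesis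
    unfolding shifted_loop_def case_prod_unfold
    by (intro continuous_on_mult continuous_on_of_real continuous_on_exp continuous_on_minus
        continuous_on_cnj continuous_on_cis continuous_on_snd continuous_on_id continuous_on_const)
qed

text \<open>
  In the derivative of the shifted loop the coefficient of \<open>cnj v\<close> is \<open>exp (\<mu> l cnj h)\<close> times a
  polynomial in \<open>l\<close>, so the negative coefficients have a complex derivative. In the coefficient of \<open>v\<close>
  the term \<open>cnj l * shifted_loop l\<close> shifts the index by one, and \<open>p cnj l exp (\<mu> l cnj h)\<close>
  contributes a single negative power, namely to index \<open>- 1\<close>.
\<close>

lemma mode_deriv:
  assumes z: "z \<in> S" and j: "j < 0"
  shows "(mode j has_field_derivative
     (- (of_real \<mu> * h' z) * mode (j + 1) z - (if j = -1 then p z / 2 else 0))) (at z)"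
proof -
  define C where "C m \<theta> = cis (- of_int m * \<theta>)" for m :: int and \<theta>
  define e where "e x \<theta> = exp (of_real \<mu> * cnj (h x) * cis \<theta>)" for x \<theta>
  \<comment> \<open>\<open>X\<close> and \<open>Y\<close> are the coefficients of \<open>v\<close> and \<open>cnj v\<close> in the derivative of the Fourier integrand\<close>
  define X where "X x \<theta> = - (of_real \<mu> * h' x) * (C (j + 1) \<theta> * shifted_loop (cis \<theta>) x)
      - 1 / 2 * (p x * (C (j + 1) \<theta> * e x \<theta>) + of_real \<mu> * h' x * of_real (u x) * (C j \<theta> * e x \<theta>))" for x \<theta>
  define Y where "Y x \<theta> = - 1 / 2 * (cnj (p x) * (C (j - 1) \<theta> * e x \<theta>)
      + of_real \<mu> * cnj (h' x) * of_real (u x) * (C j \<theta> * e x \<theta>))" for x \<theta>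
  define CNJ where "CNJ = Blinfun cnj"
  have CNJ: "blinfun_apply CNJ v = cnj v" for v
    unfolding CNJ_def by (simp add: bounded_linear_Blinfun_apply bounded_linear_cnj)
  define fx where "fx x \<theta> = blinfun_mult_right (X x \<theta>) + (blinfun_mult_right (Y x \<theta>) o\<^sub>L CNJ)" for x \<theta>
  have fx: "blinfun_apply (fx x \<theta>) v = X x \<theta> * v + Y x \<theta> * cnj v" for x \<theta> v
    by (simp add: fx_def CNJ blinfun.add_left)
  have fst: "continuous_on (S \<times> {0..2*pi}) (fst :: complex \<times> real \<Rightarrow> complex)"
    by (rule continuous_on_fst[OF continuous_on_id])
  have fstS: "fst ` (S \<times> {0..2*pi}) \<subseteq> S" by auto
  note c = continuous[THEN continuous_on_compose2, OF fst fstS]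
  have cC: "continuous_on (S \<times> {0..2*pi}) (\<lambda>x. C m (snd x))" for m
    unfolding C_def by (intro continuous_on_cis continuous_on_mult continuous_on_const continuous_on_snd continuous_on_id)
  have ce: "continuous_on (S \<times> {0..2*pi}) (\<lambda>x. e (fst x) (snd x))"
    unfolding e_def by (intro continuous_on_exp continuous_on_cis continuous_on_mult continuous_on_const continuous_on_cnj
        continuous_on_snd continuous_on_id c)
  have ck: "continuous_on (S \<times> {0..2*pi}) (\<lambda>x. shifted_loop (cis (snd x)) (fst x))"
    using shifted_loop_continuous by (simp add: case_prod_unfold)
  have cX: "continuous_on (S \<times> {0..2*pi}) (\<lambda>x. X (fst x) (snd x))"
    unfolding X_def by (intro continuous_on_diff continuous_on_add continuous_on_minus continuous_on_mult
        continuous_on_of_real continuous_on_const c cC ce ck)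
  have cY: "continuous_on (S \<times> {0..2*pi}) (\<lambda>x. Y (fst x) (snd x))"
    unfolding Y_def by (intro continuous_on_diff continuous_on_add continuous_on_minus continuous_on_mult
        continuous_on_of_real continuous_on_const continuous_on_cnj c cC ce ck)
  have slice: "continuous_on {0..2*pi} (\<lambda>\<theta>. f (z, \<theta>))" if "continuous_on (S \<times> {0..2*pi}) f" "z \<in> S"
    for f :: "complex \<times> real \<Rightarrow> complex" and z
  proof -
    have "continuous_on {0..2*pi} (Pair z)"
      by (rule continuous_on_Pair[OF continuous_on_const continuous_on_id])
    from continuous_on_compose2[OF that(1) this] that(2) show ?thesis by auto
  qed
  have "((\<lambda>x. integral (cbox 0 (2*pi)) (\<lambda>\<theta>. C j \<theta> * shifted_loop (cis \<theta>) x)) has_derivative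
      blinfun_apply (integral (cbox 0 (2*pi)) (fx z))) (at z within S)"
  proof (rule leibniz_rule[OF _ _ _ z S(2)])
    fix x \<theta> assume x: "x \<in> S"
    have c1: "C j \<theta> * (cnj (cis \<theta>) * w) = C (j + 1) \<theta> * w" "C j \<theta> * (cis \<theta> * w) = C (j - 1) \<theta> * w" for w
      by (simp_all add: C_def cis_cnj mult.assoc[symmetric] cis_mult algebra_simps)
    have "C j \<theta> * ((- (of_real \<mu> * h' x) * (cnj (cis \<theta>) * shifted_loop (cis \<theta>) x) - 1 / 2 * (p x * (cnj (cis \<theta>) * e x \<theta>) + of_real \<mu> * h' x * of_real (u x) * e x \<theta>)) * v
      + (- 1 / 2 * (cnj (p x) * (cis \<theta> * e x \<theta>) + of_real \<mu> * cnj (h' x) * of_real (u x) * e x \<theta>)) * cnj v) = blinfun_apply (fx x \<theta>) v" for v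
      unfolding fx X_def Y_def c1[symmetric] by (simp add: algebra_simps)
    then have "((\<lambda>x. C j \<theta> * shifted_loop (cis \<theta>) x) has_derivative blinfun_apply (fx x \<theta>)) (at x)"
      using has_derivative_mult_right[OF shifted_loop_deriv[of "cis \<theta>", OF _ x], of "C j \<theta>"] by (simp add: e_def)
    then show "((\<lambda>x. C j \<theta> * shifted_loop (cis \<theta>) x) has_derivative blinfun_apply (fx x \<theta>)) (at x within S)"
      by (rule has_derivative_at_withinI)
  next
    fix x assume "x \<in> S"
    then have "continuous_on {0..2*pi} (\<lambda>\<theta>. C j \<theta> * shifted_loop (cis \<theta>) x)"
      using slice[OF continuous_on_mult[OF cC ck]] by simp
    then show "(\<lambda>\<theta>. C j \<theta> * shifted_loop (cis \<theta>) x) integrable_on cbox 0 (2*pi)"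
      by (auto intro: integrable_continuous_real)
  next
    show "continuous_on (S \<times> cbox 0 (2*pi)) (\<lambda>(x, \<theta>). fx x \<theta>)"
      unfolding fx_def case_prod_unfold box_real
      by (intro continuous_on_add bounded_bilinear.continuous_on[OF bounded_bilinear_blinfun_compose]
          bounded_linear.continuous_on[OF bounded_linear_blinfun_mult_right] continuous_on_const cX cY)
  qed
  then have D: "((\<lambda>x. integral {0..2*pi} (\<lambda>\<theta>. C j \<theta> * shifted_loop (cis \<theta>) x)) has_derivative
      blinfun_apply (integral {0..2*pi} (fx z))) (at z)"
    unfolding at_within_open[OF z S(1)] box_real .
  define I where "I m = integral {0..2*pi} (\<lambda>\<theta>. C m \<theta> * e z \<theta>)" for m
  have I: "I m = (if m < 0 then 0 else (of_real \<mu> * cnj (h z)) ^ nat m / fact (nat m)) * (2 * pi)" for m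
    using wiener_loop_coeff[OF wiener_loop_exp[of "of_real \<mu> * cnj (h z)"], of m]
    by (simp add: fourier_coeff_def I_def C_def e_def field_simps)
  have ints: "(\<lambda>\<theta>. C m \<theta> * e z \<theta>) integrable_on {0..2*pi}" "(\<lambda>\<theta>. C m \<theta> * shifted_loop (cis \<theta>) z) integrable_on {0..2*pi}" for m
    using slice[OF continuous_on_mult[OF cC ce] z] slice[OF continuous_on_mult[OF cC ck] z]
    by (auto intro: integrable_continuous_real)
  have intX: "integral {0..2*pi} (X z) = - (of_real \<mu> * h' z) * integral {0..2*pi} (\<lambda>\<theta>. C (j + 1) \<theta> * shifted_loop (cis \<theta>) z)
      - 1 / 2 * (p z * I (j + 1) + of_real \<mu> * h' z * of_real (u z) * I j)"
  proof (rule integral_unique)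
    show "(X z has_integral - (of_real \<mu> * h' z) * integral {0..2*pi} (\<lambda>\<theta>. C (j + 1) \<theta> * shifted_loop (cis \<theta>) z)
      - 1 / 2 * (p z * I (j + 1) + of_real \<mu> * h' z * of_real (u z) * I j)) {0..2*pi}"
      unfolding X_def[abs_def] I_def
      by (intro has_integral_diff has_integral_add has_integral_mult_right integrable_integral ints)
  qed
  have intY: "integral {0..2*pi} (Y z) = - 1 / 2 * (cnj (p z) * I (j - 1)
      + of_real \<mu> * cnj (h' z) * of_real (u z) * I j)"
  proof (rule integral_unique)
    show "(Y z has_integral - 1 / 2 * (cnj (p z) * I (j - 1)
      + of_real \<mu> * cnj (h' z) * of_real (u z) * I j)) {0..2*pi}"
      unfolding Y_def[abs_def] I_def
      by (intro has_integral_diff has_integral_add has_integral_mult_right integrable_integral ints)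
  qed
  have Y0: "integral {0..2*pi} (Y z) = 0"
    unfolding intY I using j by simp
  have iX: "X z integrable_on {0..2*pi}" and iY: "Y z integrable_on {0..2*pi}"
    using slice[OF cX z] slice[OF cY z] by (auto intro: integrable_continuous_real)
  have ifx: "fx z integrable_on {0..2*pi}"
  proof (rule integrable_continuous_real)
    have "continuous_on {0..2*pi} (X z)" "continuous_on {0..2*pi} (Y z)"
      using slice[OF cX z] slice[OF cY z] by simp_all
    then show "continuous_on {0..2*pi} (fx z)"
      unfolding fx_def[abs_def]
      by (intro continuous_on_add bounded_bilinear.continuous_on[OF bounded_bilinear_blinfun_compose]
          bounded_linear.continuous_on[OF bounded_linear_blinfun_mult_right] continuous_on_const)
  qed
  have app: "blinfun_apply (integral {0..2*pi} (fx z)) v = integral {0..2*pi} (X z) * v" for v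
  proof -
    have "blinfun_apply (integral {0..2*pi} (fx z)) v = integral {0..2*pi} (\<lambda>\<theta>. blinfun_apply (fx z \<theta>) v)"
      using integral_linear[OF ifx blinfun.bounded_linear_left, of v] by (simp add: o_def)
    also have "\<dots> = integral {0..2*pi} (X z) * v + integral {0..2*pi} (Y z) * cnj v"
      unfolding fx using iX iY
      by (intro integral_unique has_integral_add has_integral_mult_left integrable_integral)
    finally show ?thesis by (simp add: Y0)
  qed
  have "(mode j has_derivative (\<lambda>v. integral {0..2*pi} (X z) * v / (2*pi))) (at z)"
    using has_derivative_mult_right[OF D, of "1 / (2*pi)"]
    unfolding mode_def[abs_def] fourier_coeff_def app C_def by simp
  moreover have "integral {0..2*pi} (X z) / (2*pi) =
      - (of_real \<mu> * h' z) * mode (j + 1) z - (if j = -1 then p z / 2 else 0)"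
  proof -
    have 1: "integral {0..2*pi} (\<lambda>\<theta>. C (j + 1) \<theta> * shifted_loop (cis \<theta>) z) = mode (j + 1) z * (2*pi)"
      by (simp add: mode_def fourier_coeff_def C_def)
    have 2: "I j = 0" "I (j + 1) = (if j = -1 then 2*pi else 0)"
      using j unfolding I by auto
    show ?thesis unfolding intX 1 2 by (simp add: field_simps)
  qed
  moreover have "(\<lambda>v. integral {0..2*pi} (X z) * v / (2*pi)) = (*) (integral {0..2*pi} (X z) / (2*pi))"
    by (simp add: fun_eq_iff)
  ultimately show ?thesis
    unfolding has_field_derivative_def by (simp only:)
qed


text \<open>
  The function \<open>\<xi>\<close> of the representation, as the derivative of the coefficient of index \<open>- 1\<close>.
\<close>

definition potential :: "complex \<Rightarrow> complex" where
  "potential z = - (of_real \<mu> * h' z) * mode 0 z - p z / 2"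

lemma mode_minus_one_deriv: "z \<in> S \<Longrightarrow> (mode (- 1) has_field_derivative potential z) (at z)"
  using mode_deriv[of z "-1"] by (simp add: potential_def)

lemma potential_holomorphic: "potential holomorphic_on S"
proof -
  have "mode (- 1) holomorphic_on S"
    using mode_minus_one_deriv S(1) by (auto simp: holomorphic_on_open)
  then have "deriv (mode (- 1)) holomorphic_on S"
    by (rule holomorphic_deriv[OF _ S(1)])
  then show ?thesis
    by (rule holomorphic_transform) (rule DERIV_imp_deriv[OF mode_minus_one_deriv])
qed

lemma mode_base: "mode j w0 = 0"
  by (simp add: mode_def fourier_coeff_def shifted_loop_def loop_primitive_base)

text \<open>
  The coefficients of index \<open>- 1, - 2, ...\<close> are iterated primitives starting with \<open>potential\<close>, so
  their generating function in the inverse of \<open>\<zeta>\<close> can be summed.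
\<close>

lemma negative_part:
  assumes z: "z \<in> S"
    and J: "\<And>\<zeta> x. norm \<zeta> = 1 \<Longrightarrow> x \<in> S \<Longrightarrow>
        (J \<zeta> has_field_derivative potential x * exp (inverse \<zeta> * of_real \<mu> * h x)) (at x)"
      "\<And>\<zeta>. norm \<zeta> = 1 \<Longrightarrow> J \<zeta> w0 = 0"
  shows "wiener_loop (\<lambda>\<zeta>. inverse \<zeta> * (exp (- (of_real \<mu> * h z * inverse \<zeta>)) * J \<zeta> z))
      (\<lambda>j. if j < 0 then mode j z else 0)"
proof -
  define q where "q n = mode (- 1 - int n)" for n
  have bij: "bij_betw (\<lambda>n. - 1 - int n) UNIV {..<0}"
    by (rule bij_betwI[where g = "\<lambda>j. nat (- 1 - j)"]) auto
  have all: "(\<lambda>j. norm (mode j z)) summable_on UNIV"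
    using shifted_loop_wiener[OF z] by (simp add: wiener_loop_def)
  then have "(\<lambda>j. norm (mode j z)) summable_on {..<0}"
    by (rule summable_on_subset_banach) simp
  then have nq: "(\<lambda>n. norm (q n z)) summable_on UNIV"
    by (simp add: q_def summable_on_reindex_bij_betw[OF bij, of "\<lambda>j. norm (mode j z)"])
  have 1: "(\<lambda>j. if j < 0 then mode j z else 0) abs_summable_on UNIV"
    by (rule Infinite_Sum.abs_summable_on_comparison_test'[OF all]) simp
  have 2: "((\<lambda>j. (if j < 0 then mode j z else 0) * \<zeta> powi j) has_sum
      inverse \<zeta> * (exp (- (of_real \<mu> * h z * inverse \<zeta>)) * J \<zeta> z)) UNIV" if \<zeta>: "norm \<zeta> = 1" for \<zeta>
  proof -
    have nz: "\<zeta> \<noteq> 0" using \<zeta> by auto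
    have summ: "summable (\<lambda>n. norm (q n z * inverse \<zeta> ^ n))"
      using nq \<zeta> by (simp add: norm_mult norm_power norm_inverse summable_on_UNIV_nonneg_real_iff)
    have "(\<lambda>n. q n z * inverse \<zeta> ^ n) sums (exp (- (of_real \<mu> * h z * inverse \<zeta>)) * J \<zeta> z)"
    proof (rule sums_of_iterated_primitives[where \<xi> = potential and H' = "\<lambda>x. of_real \<mu> * h' x", OF S(2,3) z])
      fix x n assume x: "x \<in> S"
      show "((\<lambda>x. of_real \<mu> * h x) has_field_derivative of_real \<mu> * h' x) (at x)"
        by (rule DERIV_cmult[OF h_deriv[OF x]])
      show "(q 0 has_field_derivative potential x) (at x)"
        using mode_minus_one_deriv[OF x] by (simp add: q_def)
      show "(q (Suc n) has_field_derivative - (of_real \<mu> * h' x * q n x)) (at x)"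
        using mode_deriv[OF x, of "- 1 - int (Suc n)"] by (simp add: q_def)
      show "(J \<zeta> has_field_derivative potential x * exp (of_real \<mu> * h x * inverse \<zeta>)) (at x)"
        using J(1)[OF \<zeta> x] by (simp add: mult_ac)
    qed (use J(2)[OF \<zeta>] summ potential_holomorphic in \<open>auto simp: q_def mode_base holomorphic_on_imp_continuous_on\<close>)
    then have "((\<lambda>n. q n z * inverse \<zeta> ^ n) has_sum (exp (- (of_real \<mu> * h z * inverse \<zeta>)) * J \<zeta> z)) UNIV"
      by (rule norm_summable_imp_has_sum[OF summ])
    from has_sum_cmult_right[OF this, of "inverse \<zeta>"]
    have "((\<lambda>n. mode (- 1 - int n) z * \<zeta> powi (- 1 - int n)) has_sum
       inverse \<zeta> * (exp (- (of_real \<mu> * h z * inverse \<zeta>)) * J \<zeta> z)) UNIV"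
      using nz by (simp add: q_def power_int_diff power_int_minus field_simps)
    then have "((\<lambda>j. mode j z * \<zeta> powi j) has_sum
       inverse \<zeta> * (exp (- (of_real \<mu> * h z * inverse \<zeta>)) * J \<zeta> z)) {..<0}"
      by (subst has_sum_reindex_bij_betw[OF bij, symmetric])
    then show ?thesis
      by (rule has_sum_cong_neutral[THEN iffD1, rotated 3]) auto
  qed
  show ?thesis unfolding wiener_loop_def using 1 2 by simp
qed

text \<open>
  Multiplying the negative part of the shifted loop, or all of it, by the power series
  \<open>exp (- \<mu> \<zeta> cnj h)\<close> produces the same negative coefficients. In the first case the product is \<open>g\<close>,
  in the second case the real loop \<open>R = exp (- E) K\<close>.
\<close>

lemma iwasawa_representation:
  assumes z: "z \<in> S"
    and J: "\<And>\<zeta> x. norm \<zeta> = 1 \<Longrightarrow> x \<in> S \<Longrightarrow>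
        (J \<zeta> has_field_derivative potential x * exp (inverse \<zeta> * of_real \<mu> * h x)) (at x)"
      "\<And>\<zeta>. norm \<zeta> = 1 \<Longrightarrow> J \<zeta> w0 = 0"
    and g: "\<And>\<zeta>. norm \<zeta> = 1 \<Longrightarrow>
        g \<zeta> = inverse \<zeta> * exp (- of_real \<mu> * (inverse \<zeta> * h z + \<zeta> * cnj (h z))) * J \<zeta> z"
  shows "\<exists>f gp. iwasawa_decomposition g f gp \<and> f (-1) - f 1 = of_real (u z)"
proof -
  define x where "x = - (of_real \<mu> * cnj (h z))"
  define R where "R \<zeta> = exp (x * \<zeta>) * shifted_loop \<zeta> z" for \<zeta>
  define e where "e j = (if j < 0 then 0 else x ^ nat j / fact (nat j))" for j
  have eW: "wiener_loop (\<lambda>\<zeta>. exp (x * \<zeta>)) e"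
    using wiener_loop_exp[of x] by (simp add: e_def[abs_def])
  have RW: "wiener_loop R (\<lambda>j. \<Sum>\<^sub>\<infinity>p\<in>{p\<in>UNIV \<times> UNIV. fst p + snd p = j}. e (fst p) * mode (snd p) z)"
    unfolding R_def by (rule wiener_loop_mult[OF eW shifted_loop_wiener[OF z]])
  have gW: "wiener_loop g (\<lambda>j. \<Sum>\<^sub>\<infinity>p\<in>{p\<in>UNIV \<times> UNIV. fst p + snd p = j}. e (fst p) * (if snd p < 0 then mode (snd p) z else 0))"
  proof (rule wiener_loop_cong[OF wiener_loop_mult[OF eW negative_part[OF z J]]])
    fix \<zeta> :: complex assume \<zeta>: "norm \<zeta> = 1"
    have "exp (- of_real \<mu> * (inverse \<zeta> * h z + \<zeta> * cnj (h z))) = exp (x * \<zeta>) * exp (- (of_real \<mu> * h z * inverse \<zeta>))"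
      unfolding exp_add[symmetric] x_def by (simp add: algebra_simps)
    then show "exp (x * \<zeta>) * (inverse \<zeta> * (exp (- (of_real \<mu> * h z * inverse \<zeta>)) * J \<zeta> z)) = g \<zeta>"
      unfolding g[OF \<zeta>] by simp
  qed
  have R: "R \<zeta> = inverse (weight \<zeta> z) * of_real (loop_primitive \<zeta> z)" for \<zeta>
  proof -
    have "exp (x * \<zeta>) * exp (- (of_real \<mu> * h z) * cnj \<zeta>) = inverse (weight \<zeta> z)"
      unfolding weight_def exp_minus[symmetric] exp_add[symmetric] x_def by (simp add: algebra_simps)
    then show ?thesis by (simp add: R_def shifted_loop_def mult.assoc[symmetric])
  qed
  have "\<exists>f gp. iwasawa_decomposition g f gp \<and> f (-1) - f 1 = R (-1) - R 1"
  proof (rule iwasawa_of_real_loop[OF RW _ gW])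
    show "cnj (R \<zeta>) = R \<zeta>" for \<zeta>
      by (simp add: R weight_real)
    fix j :: int assume j: "j < 0"
    show "(\<Sum>\<^sub>\<infinity>p\<in>{p\<in>UNIV \<times> UNIV. fst p + snd p = j}. e (fst p) * (if snd p < 0 then mode (snd p) z else 0))
        = (\<Sum>\<^sub>\<infinity>p\<in>{p\<in>UNIV \<times> UNIV. fst p + snd p = j}. e (fst p) * mode (snd p) z)"
      using j by (intro infsum_cong) (auto simp: e_def)
  qed
  moreover have "R (-1) - R 1 = of_real (u z)"
  proof -
    have "R (-1) = of_real (u z / 2)" "R 1 = of_real (- u z / 2)"
      unfolding R weight_real loop_primitive_at_units[OF z] by (simp_all add: exp_minus field_simps)
    then show ?thesis by (simp only: of_real_diff[symmetric]) simp
  qed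
  ultimately show ?thesis by simp
qed

end

section \<open>Passage to simply connected domains\<close>

context klein_gordon
begin

text \<open>
  The function \<open>\<xi>\<close> behaves like the one-form \<open>\<xi> dz\<close> under a conformal map \<open>\<psi>\<close>, and the primitives
  \<open>J\<close> are pulled back as functions; so the statement for the convex domain carries over. Taking the
  primitives as given avoids any transport of path integrals.
\<close>

lemma simply_connected_representation:
  assumes sc: "simply_connected S"
  obtains \<xi> where "\<xi> holomorphic_on S"
    and "\<And>z J g. z \<in> S \<Longrightarrow>
       (\<And>\<zeta> x. norm \<zeta> = 1 \<Longrightarrow> x \<in> S \<Longrightarrow>
          (J \<zeta> has_field_derivative \<xi> x * exp (inverse \<zeta> * of_real \<mu> * h x)) (at x)) \<Longrightarrow>
       (\<And>\<zeta>. norm \<zeta> = 1 \<Longrightarrow> J \<zeta> w0 = 0) \<Longrightarrow>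
       (\<And>\<zeta>. norm \<zeta> = 1 \<Longrightarrow>
          g \<zeta> = inverse \<zeta> * exp (- of_real \<mu> * (inverse \<zeta> * h z + \<zeta> * cnj (h z))) * J \<zeta> z) \<Longrightarrow>
       \<exists>f gp. iwasawa_decomposition g f gp \<and> f (-1) - f 1 = of_real (u z)"
proof -
  obtain T \<psi> \<eta> where T: "open T" "convex T" and \<psi>: "\<psi> holomorphic_on T" and \<eta>: "\<eta> holomorphic_on S"
    and \<eta>\<psi>: "\<And>z. z \<in> S \<Longrightarrow> \<eta> z \<in> T \<and> \<psi> (\<eta> z) = z" and \<psi>\<eta>: "\<And>t. t \<in> T \<Longrightarrow> \<psi> t \<in> S \<and> \<eta> (\<psi> t) = t"
  proof (cases "S = UNIV")
    case True
    show thesis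
      by (rule that[of UNIV "\<lambda>x. x" "\<lambda>x. x"]) (use True in auto)
  next
    case False
    then obtain f g where fg: "f holomorphic_on S" "g holomorphic_on ball 0 1"
        "\<forall>z\<in>S. f z \<in> ball 0 1 \<and> g (f z) = z" "\<forall>z\<in>ball 0 1. g z \<in> S \<and> f (g z) = z"
      using sc simply_connected_eq_biholomorphic_to_disc[OF domain(1)] domain(2) by (metis empty_iff)
    show thesis
      by (rule that[of "ball 0 1" g f]) (use fg in auto)
  qed
  define t0 where "t0 = \<eta> w0"
  have t0: "t0 \<in> T" "\<psi> t0 = w0" using \<eta>\<psi>[OF domain(2)] by (auto simp: t0_def)
  interpret P: klein_gordon_convex T t0 \<mu> "\<lambda>t. h (\<psi> t)" "\<lambda>t. h' (\<psi> t) * deriv \<psi> t"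
    "\<lambda>t. h'' (\<psi> t) * deriv \<psi> t * deriv \<psi> t + h' (\<psi> t) * deriv (deriv \<psi>) t"
    "\<lambda>t. p (\<psi> t) * deriv \<psi> t"
    "\<lambda>t. r (\<psi> t) * deriv \<psi> t * deriv \<psi> t + p (\<psi> t) * deriv (deriv \<psi>) t"
    "\<lambda>t. u (\<psi> t)"
    using pullback[OF T(1) t0(1) \<psi> _ t0(2)] \<psi>\<eta>
    by (intro klein_gordon_convex.intro klein_gordon_convex_axioms.intro T) blast
  define \<xi> where "\<xi> z = P.potential (\<eta> z) * deriv \<eta> z" for z
  have "(P.potential \<circ> \<eta>) holomorphic_on S"
    by (rule holomorphic_on_compose_gen[OF \<eta> P.potential_holomorphic]) (use \<eta>\<psi> in auto)
  then have hol: "\<xi> holomorphic_on S"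
    unfolding \<xi>_def[abs_def] o_def
    by (intro holomorphic_on_mult holomorphic_deriv[OF \<eta> domain(1)])
  have chain: "deriv \<eta> (\<psi> t) * deriv \<psi> t = 1" if t: "t \<in> T" for t
  proof -
    have "((\<lambda>t. \<eta> (\<psi> t)) has_field_derivative deriv \<eta> (\<psi> t) * deriv \<psi> t) (at t)"
      by (rule DERIV_chain2[OF holomorphic_derivI[OF \<eta> domain(1)] holomorphic_derivI[OF \<psi> T(1) t]]) (use \<psi>\<eta> t in auto)
    moreover have "((\<lambda>t. \<eta> (\<psi> t)) has_field_derivative 1) (at t)"
      by (rule has_field_derivative_transform_within_open[OF DERIV_ident T(1) t]) (use \<psi>\<eta> in auto)
    ultimately show ?thesis by (rule DERIV_unique)
  qed
  show thesis
  proof (rule that[OF hol])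
    fix z J g
    assume z: "z \<in> S"
      and J: "\<And>\<zeta> x. norm \<zeta> = 1 \<Longrightarrow> x \<in> S \<Longrightarrow>
          (J \<zeta> has_field_derivative \<xi> x * exp (inverse \<zeta> * of_real \<mu> * h x)) (at x)"
      and J0: "\<And>\<zeta>. norm \<zeta> = 1 \<Longrightarrow> J \<zeta> w0 = 0"
      and g: "\<And>\<zeta>. norm \<zeta> = 1 \<Longrightarrow>
          g \<zeta> = inverse \<zeta> * exp (- of_real \<mu> * (inverse \<zeta> * h z + \<zeta> * cnj (h z))) * J \<zeta> z"
    have "\<exists>f gp. iwasawa_decomposition g f gp \<and> f (-1) - f 1 = of_real (u (\<psi> (\<eta> z)))"
    proof (rule P.iwasawa_representation[where J = "\<lambda>\<zeta> t. J \<zeta> (\<psi> t)"])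
      show "\<eta> z \<in> T" using \<eta>\<psi>[OF z] by simp
      show "J \<zeta> (\<psi> t0) = 0" if "norm \<zeta> = 1" for \<zeta> using J0[OF that] t0 by simp
      show "g \<zeta> = inverse \<zeta> * exp (- of_real \<mu> * (inverse \<zeta> * h (\<psi> (\<eta> z)) + \<zeta> * cnj (h (\<psi> (\<eta> z))))) * J \<zeta> (\<psi> (\<eta> z))"
        if "norm \<zeta> = 1" for \<zeta>
        using g[OF that] \<eta>\<psi>[OF z] by simp
      fix \<zeta> :: complex and t assume \<zeta>: "norm \<zeta> = 1" and t: "t \<in> T"
      have "((\<lambda>t. J \<zeta> (\<psi> t)) has_field_derivative
         \<xi> (\<psi> t) * exp (inverse \<zeta> * of_real \<mu> * h (\<psi> t)) * deriv \<psi> t) (at t)"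
        by (rule DERIV_chain2[OF J[OF \<zeta>] holomorphic_derivI[OF \<psi> T(1) t]]) (use \<psi>\<eta> t in auto)
      moreover have "\<xi> (\<psi> t) * exp (inverse \<zeta> * of_real \<mu> * h (\<psi> t)) * deriv \<psi> t
         = P.potential t * exp (inverse \<zeta> * of_real \<mu> * h (\<psi> t)) * (deriv \<eta> (\<psi> t) * deriv \<psi> t)"
        using \<psi>\<eta>[OF t] by (simp add: \<xi>_def mult_ac)
      ultimately show "((\<lambda>t. J \<zeta> (\<psi> t)) has_field_derivative
         P.potential t * exp (inverse \<zeta> * of_real \<mu> * h (\<psi> t))) (at t)"
        by (simp add: chain[OF t])
    qed
    then show "\<exists>f gp. iwasawa_decomposition g f gp \<and> f (-1) - f 1 = of_real (u z)"
      using \<eta>\<psi>[OF z] by simp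
  qed
qed

end

section \<open>Second derivatives in complex form\<close>

text \<open>
  The left side of the conclusion is symmetric under exchanging the two variables, the right side
  is a mixed derivative. Applied in both orders on shrinking squares, this yields the symmetry of
  mixed derivatives.
\<close>

lemma second_difference:
  fixes F A B :: "real \<Rightarrow> real \<Rightarrow> real"
  assumes t: "0 < t"
    and A: "\<And>x y. x \<in> {a..a+t} \<Longrightarrow> y \<in> {b..b+t} \<Longrightarrow> ((\<lambda>x. F x y) has_real_derivative A x y) (at x)"
    and B: "\<And>x y. x \<in> {a..a+t} \<Longrightarrow> y \<in> {b..b+t} \<Longrightarrow> ((\<lambda>y. A x y) has_real_derivative B x y) (at y)"
  obtains x y where "x \<in> {a..a+t}" "y \<in> {b..b+t}"
    "F (a + t) (b + t) - F (a + t) b - F a (b + t) + F a b = t * t * B x y"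
proof -
  have "\<exists>x>a. x < a + t \<and> (F (a + t) (b + t) - F (a + t) b) - (F a (b + t) - F a b)
      = (a + t - a) * (A x (b + t) - A x b)"
    using t by (intro MVT2) (auto intro!: DERIV_diff A)
  then obtain x where x: "a < x" "x < a + t"
      "(F (a + t) (b + t) - F (a + t) b) - (F a (b + t) - F a b) = t * (A x (b + t) - A x b)" by auto
  have "\<exists>y>b. y < b + t \<and> A x (b + t) - A x b = (b + t - b) * B x y"
    using t x by (intro MVT2) (auto intro!: B)
  then obtain y where "b < y" "y < b + t" "A x (b + t) - A x b = t * B x y" by auto
  with x that[of x y] show thesis by auto
qed

lemma mixed_partials_eq:
  fixes f fx fy fxx fxy fyx fyy :: "complex \<Rightarrow> real"
  assumes D: "open D" "z \<in> D"
    and f: "\<And>w. w \<in> D \<Longrightarrow> (f has_derivative (\<lambda>v. fx w * Re v + fy w * Im v)) (at w)"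
    and fx: "\<And>w. w \<in> D \<Longrightarrow> (fx has_derivative (\<lambda>v. fxx w * Re v + fxy w * Im v)) (at w)"
    and fy: "\<And>w. w \<in> D \<Longrightarrow> (fy has_derivative (\<lambda>v. fyx w * Re v + fyy w * Im v)) (at w)"
    and cont: "continuous_on D fxy" "continuous_on D fyx"
  shows "fxy z = fyx z"
proof (rule ccontr)
  assume ne: "fxy z \<noteq> fyx z"
  define e where "e = \<bar>fxy z - fyx z\<bar> / 2"
  have e: "e > 0" using ne by (simp add: e_def)
  have "isCont fxy z" "isCont fyx z"
    using cont D by (auto simp: continuous_on_eq_continuous_at)
  then obtain d1 d2 where d1: "d1 > 0" "\<And>w. dist w z < d1 \<Longrightarrow> dist (fxy w) (fxy z) < e"
      and d2: "d2 > 0" "\<And>w. dist w z < d2 \<Longrightarrow> dist (fyx w) (fyx z) < e"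
    unfolding continuous_at_eps_delta using e by metis
  obtain d3 where d3: "d3 > 0" "ball z d3 \<subseteq> D" using D by (auto simp: open_contains_ball)
  define t where "t = min d1 (min d2 d3) / 4"
  have t: "t > 0" using d1 d2 d3 by (simp add: t_def)
  have near: "dist (Complex x y) z < min d1 (min d2 d3)"
    if "x \<in> {Re z..Re z + t}" "y \<in> {Im z..Im z + t}" for x y
  proof -
    have "norm (Complex x y - z) \<le> \<bar>Re (Complex x y - z)\<bar> + \<bar>Im (Complex x y - z)\<bar>" by (rule cmod_le)
    also have "\<dots> \<le> 2 * t" using that by auto
    also have "\<dots> < min d1 (min d2 d3)" using d1 d2 d3 by (auto simp: t_def)
    finally show ?thesis by (simp add: dist_norm)
  qed
  have inD: "Complex x y \<in> D" if "x \<in> {Re z..Re z + t}" "y \<in> {Im z..Im z + t}" for x y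
    using near[OF that] d3 by (auto simp: dist_commute)
  have partial_x: "((\<lambda>x. k (Complex x y)) has_real_derivative kx (Complex x y)) (at x)"
    if "(k has_derivative (\<lambda>v. kx (Complex x y) * Re v + ky (Complex x y) * Im v)) (at (Complex x y))"
    for k kx ky :: "complex \<Rightarrow> real" and x y
  proof -
    have "((\<lambda>x. Complex x y) has_derivative (\<lambda>s. Complex s 0)) (at x)"
      unfolding Complex_eq by (auto intro!: derivative_eq_intros)
    from has_derivative_compose[OF this that] show ?thesis by (simp add: has_field_derivative_def mult_commute_abs)
  qed
  have partial_y: "((\<lambda>y. k (Complex x y)) has_real_derivative ky (Complex x y)) (at y)"
    if "(k has_derivative (\<lambda>v. kx (Complex x y) * Re v + ky (Complex x y) * Im v)) (at (Complex x y))"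
    for k kx ky :: "complex \<Rightarrow> real" and x y
  proof -
    have "((\<lambda>y. Complex x y) has_derivative (\<lambda>s. Complex 0 s)) (at y)"
      unfolding Complex_eq by (auto intro!: derivative_eq_intros)
    from has_derivative_compose[OF this that] show ?thesis by (simp add: has_field_derivative_def mult_commute_abs)
  qed
  obtain x y where 1: "x \<in> {Re z..Re z + t}" "y \<in> {Im z..Im z + t}"
    "f (Complex (Re z + t) (Im z + t)) - f (Complex (Re z + t) (Im z)) - f (Complex (Re z) (Im z + t)) + f (Complex (Re z) (Im z))
      = t * t * fxy (Complex x y)"
    by (rule second_difference[OF t, of "Re z" "Im z" "\<lambda>x y. f (Complex x y)" "\<lambda>x y. fx (Complex x y)" "\<lambda>x y. fxy (Complex x y)"])
      (auto intro!: partial_x[where k = f and kx = fx and ky = fy, OF f] partial_y[where k = fx and kx = fxx and ky = fxy, OF fx] inD)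
  obtain y' x' where 2: "y' \<in> {Im z..Im z + t}" "x' \<in> {Re z..Re z + t}"
    "f (Complex (Re z + t) (Im z + t)) - f (Complex (Re z) (Im z + t)) - f (Complex (Re z + t) (Im z)) + f (Complex (Re z) (Im z))
      = t * t * fyx (Complex x' y')"
    by (rule second_difference[OF t, of "Im z" "Re z" "\<lambda>y x. f (Complex x y)" "\<lambda>y x. fy (Complex x y)" "\<lambda>y x. fyx (Complex x y)"])
      (auto intro!: partial_y[where k = f and kx = fx and ky = fy, OF f] partial_x[where k = fy and kx = fyx and ky = fyy, OF fy] inD)
  have "t * t * fxy (Complex x y) = t * t * fyx (Complex x' y')" using 1(3) 2(3) by linarith
  then have "fxy (Complex x y) = fyx (Complex x' y')" using t by simp
  moreover have "dist (fxy (Complex x y)) (fxy z) < e" using d1(2) near[OF 1(1,2)] by simp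
  moreover have "dist (fyx (Complex x' y')) (fyx z) < e" using d2(2) near[OF 2(2,1)] by simp
  moreover have "\<bar>fxy z - fyx z\<bar> \<le> \<bar>X - fxy z\<bar> + \<bar>X - fyx z\<bar>" for X by arith
  ultimately show False unfolding e_def dist_real_def by (smt (verit) field_sum_of_halves)
qed


text \<open>
  The \<open>cnj z\<close>-derivative of \<open>\<partial>f/\<partial>z\<close> is a quarter of the Laplacian; its imaginary part, a difference
  of mixed derivatives, vanishes.
\<close>

lemma wirtinger_derivative:
  fixes f fx fy fxx fxy fyx fyy :: "complex \<Rightarrow> real"
  assumes D: "open D"
    and f: "\<And>w. w \<in> D \<Longrightarrow> (f has_derivative (\<lambda>v. fx w * Re v + fy w * Im v)) (at w)"
    and fx: "\<And>w. w \<in> D \<Longrightarrow> (fx has_derivative (\<lambda>v. fxx w * Re v + fxy w * Im v)) (at w)"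
    and fy: "\<And>w. w \<in> D \<Longrightarrow> (fy has_derivative (\<lambda>v. fyx w * Re v + fyy w * Im v)) (at w)"
    and cont: "continuous_on D fxy" "continuous_on D fyx"
    and z: "z \<in> D"
  shows "(f has_derivative (\<lambda>v. 2 * Re (Complex (fx z / 2) (- fy z / 2) * v))) (at z)"
    and "((\<lambda>w. Complex (fx w / 2) (- fy w / 2)) has_derivative
       (\<lambda>v. Complex ((fxx z - fyy z) / 4) (- fxy z / 2) * v + of_real ((fxx z + fyy z) / 4) * cnj v)) (at z)"
proof -
  show "(f has_derivative (\<lambda>v. 2 * Re (Complex (fx z / 2) (- fy z / 2) * v))) (at z)"
    by (rule has_derivative_eq_rhs[OF f[OF z]]) (simp add: fun_eq_iff)
  have eq: "fyx z = fxy z"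
    using mixed_partials_eq[OF D z f fx fy cont] by simp
  have C: "(\<lambda>w. Complex (fx w / 2) (- fy w / 2)) = (\<lambda>w. of_real (1 / 2 * fx w) + \<i> * of_real (- 1 / 2 * fy w))"
    by (simp add: fun_eq_iff complex_eq_iff)
  have "((\<lambda>w. of_real (1 / 2 * fx w) + \<i> * of_real (- 1 / 2 * fy w)) has_derivative
     (\<lambda>v. of_real (1 / 2 * (fxx z * Re v + fxy z * Im v)) + \<i> * of_real (- 1 / 2 * (fyx z * Re v + fyy z * Im v)))) (at z)"
    by (intro has_derivative_add has_derivative_mult_right has_derivative_of_real fx[OF z] fy[OF z])
  moreover have "of_real (1 / 2 * (fxx z * Re v + fxy z * Im v)) + \<i> * of_real (- 1 / 2 * (fyx z * Re v + fyy z * Im v))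
     = Complex ((fxx z - fyy z) / 4) (- fxy z / 2) * v + of_real ((fxx z + fyy z) / 4) * cnj v" for v
  proof -
    have "1 / 2 * (a * x + b * y) = (a - d) / 4 * x - (- b / 2 * y) + (a + d) / 4 * x"
      "- 1 / 2 * (b * x + d * y) = (a - d) / 4 * y + - b / 2 * x - (a + d) / 4 * y" for a b d x y :: real
      by (simp_all add: field_simps)
    then show ?thesis unfolding complex_eq_iff eq by simp
  qed
  ultimately show "((\<lambda>w. Complex (fx w / 2) (- fy w / 2)) has_derivative
       (\<lambda>v. Complex ((fxx z - fyy z) / 4) (- fxy z / 2) * v + of_real ((fxx z + fyy z) / 4) * cnj v)) (at z)"
    unfolding C by (simp only:)
qed

definition partial_deriv :: "complex \<Rightarrow> (complex \<Rightarrow> real^3) \<Rightarrow> complex \<Rightarrow> real^3" where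
  "partial_deriv b \<phi> w = frechet_derivative \<phi> (at w) b"

lemma Ck_on_partial_deriv:
  assumes "Ck_on (Suc n) D \<phi>"
  shows "Ck_on n D (partial_deriv b \<phi>)"
  using assms by (simp add: partial_deriv_def[abs_def])

lemma Ck_on_has_derivative:
  assumes "Ck_on (Suc n) D \<phi>" "z \<in> D"
  shows "((\<lambda>w. \<phi> w $ k) has_derivative (\<lambda>v. partial_deriv 1 \<phi> z $ k * Re v + partial_deriv \<i> \<phi> z $ k * Im v)) (at z)"
proof -
  have d: "(\<phi> has_derivative frechet_derivative \<phi> (at z)) (at z)"
    using assms by (simp add: frechet_derivative_works)
  then have lin: "linear (frechet_derivative \<phi> (at z))"
    by (rule has_derivative_linear)
  have "frechet_derivative \<phi> (at z) v = Re v *\<^sub>R partial_deriv 1 \<phi> z + Im v *\<^sub>R partial_deriv \<i> \<phi> z" for v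
  proof -
    have "v = Re v *\<^sub>R 1 + Im v *\<^sub>R \<i>" by (simp add: complex_eq_iff)
    then have "frechet_derivative \<phi> (at z) v = frechet_derivative \<phi> (at z) (Re v *\<^sub>R 1 + Im v *\<^sub>R \<i>)" by simp
    then show ?thesis by (simp add: linear_add[OF lin] linear_scale[OF lin] partial_deriv_def)
  qed
  then have "(\<lambda>v. frechet_derivative \<phi> (at z) v $ k) = (\<lambda>v. partial_deriv 1 \<phi> z $ k * Re v + partial_deriv \<i> \<phi> z $ k * Im v)"
    by (simp add: fun_eq_iff mult.commute)
  with bounded_linear.has_derivative[OF bounded_linear_vec_nth d] show ?thesis by metis
qed

lemma Ck_on_continuous:
  assumes "Ck_on n D \<phi>"
  shows "continuous_on D \<phi>"
  using assms by (cases n) (auto intro!: continuous_at_imp_continuous_on differentiable_imp_continuous_within)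

definition laplacian :: "(complex \<Rightarrow> real^3) \<Rightarrow> complex \<Rightarrow> real^3" where
  "laplacian \<phi> z = partial_deriv 1 (partial_deriv 1 \<phi>) z + partial_deriv \<i> (partial_deriv \<i> \<phi>) z"

text \<open>
  The derivative \<open>\<partial>\<phi>\<^sup>k/\<partial>z\<close>.
\<close>

definition wirtinger :: "(complex \<Rightarrow> real^3) \<Rightarrow> 3 \<Rightarrow> complex \<Rightarrow> complex" where
  "wirtinger \<phi> k z = Complex (partial_deriv 1 \<phi> z $ k / 2) (- partial_deriv \<i> \<phi> z $ k / 2)"

lemma smooth_wirtinger:
  assumes D: "open D" and \<phi>: "smooth_map_on D \<phi>"
  obtains r where "continuous_on D r"
    and "\<And>z. z \<in> D \<Longrightarrow> ((\<lambda>w. \<phi> w $ k) has_derivative (\<lambda>v. 2 * Re (wirtinger \<phi> k z * v))) (at z)"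
    and "\<And>z. z \<in> D \<Longrightarrow> (wirtinger \<phi> k has_derivative
       (\<lambda>v. r z * v + of_real (laplacian \<phi> z $ k / 4) * cnj v)) (at z)"
proof -
  have C2: "Ck_on (Suc (Suc 0)) D \<phi>" using \<phi> by (auto simp: smooth_map_on_def simp del: Ck_on.simps)
  have C1: "Ck_on (Suc 0) D (partial_deriv b \<phi>)" for b by (rule Ck_on_partial_deriv[OF C2])
  have C0: "Ck_on 0 D (partial_deriv a (partial_deriv b \<phi>))" for a b by (rule Ck_on_partial_deriv[OF C1])
  have c: "continuous_on D (\<lambda>w. partial_deriv a (partial_deriv b \<phi>) w $ k)" for a b
    by (intro bounded_linear.continuous_on[OF bounded_linear_vec_nth] Ck_on_continuous[OF C0])
  \<comment> \<open>the second derivative \<open>\<partial>\<^sup>2\<phi>\<^sup>k/\<partial>z\<^sup>2\<close>\<close>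
  define r where "r z = Complex ((partial_deriv 1 (partial_deriv 1 \<phi>) z $ k - partial_deriv \<i> (partial_deriv \<i> \<phi>) z $ k) / 4)
     (- partial_deriv \<i> (partial_deriv 1 \<phi>) z $ k / 2)" for z
  note W = wirtinger_derivative[OF D Ck_on_has_derivative[OF C2] Ck_on_has_derivative[OF C1] Ck_on_has_derivative[OF C1] c c]
  show thesis
  proof (rule that[of r])
    show "continuous_on D r"
      unfolding r_def[abs_def] Complex_eq by (intro continuous_intros c) auto
    show "((\<lambda>w. \<phi> w $ k) has_derivative (\<lambda>v. 2 * Re (wirtinger \<phi> k z * v))) (at z)" if "z \<in> D" for z
      using W(1)[OF _ _ _ that] by (simp add: wirtinger_def)
    show "(wirtinger \<phi> k has_derivative
       (\<lambda>v. r z * v + of_real (laplacian \<phi> z $ k / 4) * cnj v)) (at z)" if "z \<in> D" for z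
      using W(2)[OF _ _ _ that] unfolding wirtinger_def[abs_def] r_def laplacian_def by simp
  qed
qed

section \<open>The equations of a harmonic map\<close>

text \<open>
  In dimension two the Christoffel symbols of a conformally flat metric have trace zero, so tension
  fields are computed with the flat Laplacian. This follows from the six equations for a parallel
  metric together with symmetry, without solving for the connection.
\<close>

lemma levi_civita_trace:
  assumes L: "levi_civita_on D \<rho> L" and pos: "\<rho> z > 0" and z: "z \<in> D"
  shows "L z 1 1 + L z \<i> \<i> = 0"
proof -
  have sym: "L z u v = L z v u" for u v
    using L z unfolding levi_civita_on_def by blast
  have par: "frechet_derivative (\<lambda>x. \<rho> x * (v \<bullet> w)) (at z) u = \<rho> z * (L z u v \<bullet> w) + \<rho> z * (v \<bullet> L z u w)" for u v w
    using L z unfolding levi_civita_on_def by blast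
  have 0: "frechet_derivative (\<lambda>x. \<rho> x * 0) (at z) u = 0" for u
    by (simp add: frechet_derivative_const)
  define F where "F u = frechet_derivative (\<lambda>x. \<rho> x * 1) (at z) u" for u
  have ip: "1 \<bullet> (1::complex) = 1" "\<i> \<bullet> \<i> = 1" "1 \<bullet> \<i> = 0" "\<i> \<bullet> 1 = 0"
    by (simp_all add: inner_complex_def)
  have e: "F 1 = 2 * (\<rho> z * Re (L z 1 1))" "F 1 = 2 * (\<rho> z * Im (L z 1 \<i>))"
    "F \<i> = 2 * (\<rho> z * Im (L z \<i> \<i>))" "F \<i> = 2 * (\<rho> z * Re (L z 1 \<i>))"
    "0 = \<rho> z * (Im (L z 1 1) + Re (L z 1 \<i>))" "0 = \<rho> z * (Im (L z 1 \<i>) + Re (L z \<i> \<i>))"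
    using par[of 1 1 1] par[of \<i> \<i> 1] par[of \<i> \<i> \<i>] par[of 1 1 \<i>] par[of 1 \<i> 1] par[of 1 \<i> \<i>]
    unfolding ip F_def[symmetric] 0 sym[of \<i> 1]
    by (simp_all add: inner_complex_def algebra_simps)
  have "\<rho> z * Re (L z 1 1) = \<rho> z * Im (L z 1 \<i>)" "\<rho> z * Im (L z \<i> \<i>) = \<rho> z * Re (L z 1 \<i>)"
    using e(1-4) by auto
  then show ?thesis using e(5,6) pos by (simp add: complex_eq_iff)
qed

text \<open>
  The trace of \<open>\<nabla>d\<phi>\<close> is the flat Laplacian plus the Christoffel terms of the target. These are
  products of first derivatives, and \<open>f\<^sub>x g\<^sub>x + f\<^sub>y g\<^sub>y = 4 Re (f\<^sub>z cnj (g\<^sub>z))\<close> for real functions.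
\<close>

lemma harmonic_map_laplacian:
  assumes N: "neutral_connection \<mu>1 \<mu>2 C" and H: "harmonic_map_on C D \<phi>" and z: "z \<in> D"
  shows "laplacian \<phi> z $ 3 = 0"
    and "(k, \<mu>) \<in> {(1, \<mu>1), (2, \<mu>2)} \<Longrightarrow>
       laplacian \<phi> z $ k = 4 * \<mu> * Re (wirtinger \<phi> 3 z * cnj (wirtinger \<phi> k z))"
proof -
  obtain \<rho> L where \<rho>: "\<rho> z > 0" and L: "levi_civita_on D \<rho> L"
    and tr: "(\<Sum>b\<in>Basis. (1 / \<rho> z) *\<^sub>R nabla_d C L \<phi> (\<lambda>_. b) (\<lambda>_. b) z) = 0"
    using H z unfolding harmonic_map_on_def hermitian_metric_on_def by blast
  have d: "\<phi> differentiable (at z)"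
  proof -
    have "Ck_on (Suc 0) D \<phi>" using H by (auto simp: harmonic_map_on_def smooth_map_on_def simp del: Ck_on.simps)
    then show ?thesis using z by simp
  qed
  then have lin: "linear (frechet_derivative \<phi> (at z))"
    by (rule linear_frechet_derivative)
  have n: "nabla_d C L \<phi> (\<lambda>_. b) (\<lambda>_. b) z =
      partial_deriv b (partial_deriv b \<phi>) z + C (\<phi> z) (partial_deriv b \<phi> z) (partial_deriv b \<phi> z)
      - frechet_derivative \<phi> (at z) (L z b b)" for b
    by (simp add: nabla_d_def pullback_deriv_def cov_deriv_def partial_deriv_def[abs_def] frechet_derivative_const)
  have "nabla_d C L \<phi> (\<lambda>_. 1) (\<lambda>_. 1) z + nabla_d C L \<phi> (\<lambda>_. \<i>) (\<lambda>_. \<i>) z = 0"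
    using tr \<rho> by (simp add: Basis_complex_def scaleR_add_right[symmetric])
  moreover have "frechet_derivative \<phi> (at z) (L z 1 1) + frechet_derivative \<phi> (at z) (L z \<i> \<i>) = 0"
    using levi_civita_trace[OF L \<rho> z] linear_add[OF lin] linear_0[OF lin] by metis
  ultimately have "laplacian \<phi> z + (C (\<phi> z) (partial_deriv 1 \<phi> z) (partial_deriv 1 \<phi> z)
     + C (\<phi> z) (partial_deriv \<i> \<phi> z) (partial_deriv \<i> \<phi> z)) = 0"
    unfolding n laplacian_def by (simp add: algebra_simps)
  then have "laplacian \<phi> z = - (C (\<phi> z) (partial_deriv 1 \<phi> z) (partial_deriv 1 \<phi> z)
     + C (\<phi> z) (partial_deriv \<i> \<phi> z) (partial_deriv \<i> \<phi> z))"
    by (rule eq_neg_iff_add_eq_0[THEN iffD2])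
  then have lap: "laplacian \<phi> z $ i = - (C (\<phi> z) (partial_deriv 1 \<phi> z) (partial_deriv 1 \<phi> z) $ i
     + C (\<phi> z) (partial_deriv \<i> \<phi> z) (partial_deriv \<i> \<phi> z) $ i)" for i
    by simp
  have C: "C = (\<lambda>p v w. vector [- (\<mu>1/2) * (v$3 * w$1 + v$1 * w$3), - (\<mu>2/2) * (v$3 * w$2 + v$2 * w$3), 0])"
    using N by (simp only: neutral_connection_iff)
  show "laplacian \<phi> z $ 3 = 0"
    and "(k, \<mu>) \<in> {(1, \<mu>1), (2, \<mu>2)} \<Longrightarrow>
       laplacian \<phi> z $ k = 4 * \<mu> * Re (wirtinger \<phi> 3 z * cnj (wirtinger \<phi> k z))"
    unfolding lap C by (auto simp: vector_3 wirtinger_def field_simps)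
qed

section \<open>The representation formula\<close>

lemma path_subpath_contour_integral:
  assumes F: "\<And>x. x \<in> D \<Longrightarrow> (F has_field_derivative f x) (at x)"
    and \<gamma>: "valid_path \<gamma>" "path_image \<gamma> \<subseteq> D" and s: "s \<in> {0..1}"
  shows "contour_integral (subpath 0 s \<gamma>) f = F (\<gamma> s) - F (pathstart \<gamma>)"
proof -
  have "(f has_contour_integral (F (pathfinish (subpath 0 s \<gamma>)) - F (pathstart (subpath 0 s \<gamma>)))) (subpath 0 s \<gamma>)"
  proof (rule contour_integral_primitive[where S = D])
    show "valid_path (subpath 0 s \<gamma>)" using \<gamma> s by (intro valid_path_subpath) auto
    show "path_image (subpath 0 s \<gamma>) \<subseteq> D"
      using \<gamma>(2) s path_image_subpath_subset[of 0 s \<gamma>] by auto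
  qed (use F in \<open>auto intro: has_field_derivative_at_within\<close>)
  then show ?thesis by (simp add: contour_integral_unique pathstart_def pathfinish_def subpath_def)
qed

text \<open>
  On a domain where the integrands have primitives the nested path integrals depend on the end point
  only.
\<close>

lemma scalar_loop_eq:
  assumes h: "\<And>x. x \<in> D \<Longrightarrow> (h has_field_derivative \<xi>3 x) (at x)" "h z0 = 0"
    and J: "\<And>x. x \<in> D \<Longrightarrow> (J has_field_derivative \<xi>k x * exp (inverse \<zeta> * of_real \<mu> * h x)) (at x)" "J z0 = 0"
    and \<gamma>: "valid_path \<gamma>" "path_image \<gamma> \<subseteq> D" "pathstart \<gamma> = z0" "pathfinish \<gamma> = z"
  shows "scalar_loop \<mu> \<xi>k \<xi>3 \<gamma> \<zeta> =
     inverse \<zeta> * exp (- of_real \<mu> * (inverse \<zeta> * h z + \<zeta> * cnj (h z))) * J z"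
proof -
  have hz: "contour_integral \<gamma> \<xi>3 = h z"
    using contour_integral_primitive[of D h \<xi>3 \<gamma>] h \<gamma>
    by (auto intro!: contour_integral_unique simp: has_field_derivative_at_within)
  have "((\<lambda>x. \<xi>k x * exp (inverse \<zeta> * of_real \<mu> * h x)) has_contour_integral J z - J z0) \<gamma>"
    using contour_integral_primitive[of D J _ \<gamma>] J \<gamma> by (auto simp: has_field_derivative_at_within)
  then have "integral {0..1} (\<lambda>s. \<xi>k (\<gamma> s) * exp (inverse \<zeta> * of_real \<mu> * h (\<gamma> s)) *
       vector_derivative \<gamma> (at s within {0..1})) = J z"
    unfolding has_contour_integral_def using J(2) by (simp add: integral_unique)
  moreover have inner: "contour_integral (subpath 0 s \<gamma>) \<xi>3 = h (\<gamma> s)" if "s \<in> {0..1}" for s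
    using path_subpath_contour_integral[OF h(1) \<gamma>(1,2) that] h(2) \<gamma>(3) by simp
  have "integral {0..1} (\<lambda>s. \<xi>k (\<gamma> s) *
       exp (inverse \<zeta> * of_real \<mu> * contour_integral (subpath 0 s \<gamma>) \<xi>3) *
       vector_derivative \<gamma> (at s within {0..1})) = integral {0..1} (\<lambda>s. \<xi>k (\<gamma> s) *
       exp (inverse \<zeta> * of_real \<mu> * h (\<gamma> s)) * vector_derivative \<gamma> (at s within {0..1}))"
    by (rule integral_cong) (simp only: inner)
  ultimately have "integral {0..1} (\<lambda>s. \<xi>k (\<gamma> s) *
       exp (inverse \<zeta> * of_real \<mu> * contour_integral (subpath 0 s \<gamma>) \<xi>3) *
       vector_derivative \<gamma> (at s within {0..1})) = J z"
    by simp
  moreover have "- 2 * of_real \<mu> * loop_Re (\<lambda>\<eta>. inverse \<eta> * contour_integral \<gamma> \<xi>3) \<zeta>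
      = - of_real \<mu> * (inverse \<zeta> * h z + \<zeta> * cnj (h z))"
    by (simp add: loop_Re_def hz)
  ultimately show ?thesis unfolding scalar_loop_def by (simp only:)
qed

text \<open>
  Multiplication by the integrating factor \<open>exp (2 \<mu> Re h)\<close> cancels the first order terms of the
  harmonic map equation \<open>\<Delta> f = - 8 \<mu> Re (h' cnj (\<partial>f/\<partial>z))\<close> against those from the product rule.
\<close>

lemma klein_gordon_of_harmonic:
  assumes D: "open D" "z0 \<in> D"
    and h: "\<And>z. z \<in> D \<Longrightarrow> (h has_field_derivative h' z) (at z)" "h' holomorphic_on D" "h z0 = 0"
    and f: "\<And>z. z \<in> D \<Longrightarrow> (f has_derivative (\<lambda>v. 2 * Re (P z * v))) (at z)" "f z0 = 0"
    and P: "\<And>z. z \<in> D \<Longrightarrow> (P has_derivative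
       (\<lambda>v. r z * v + of_real (- 2 * \<mu> * Re (h' z * cnj (P z))) * cnj v)) (at z)"
    and r: "continuous_on D r"
  shows "klein_gordon D z0 \<mu> h h' (deriv h')
     (\<lambda>z. of_real (exp (2 * \<mu> * Re (h z))) * (P z + of_real \<mu> * h' z * of_real (f z)))
     (\<lambda>z. of_real (exp (2 * \<mu> * Re (h z))) * (of_real \<mu> * h' z * (P z + of_real \<mu> * h' z * of_real (f z))
         + r z + of_real \<mu> * deriv h' z * of_real (f z) + of_real \<mu> * h' z * P z))
     (\<lambda>z. exp (2 * \<mu> * Re (h z)) * f z)"
proof
  show "open D" "z0 \<in> D" "h z0 = 0" by fact+
  show "exp (2 * \<mu> * Re (h z0)) * f z0 = 0" by (simp add: f)
  show "(h has_field_derivative h' z) (at z)" if "z \<in> D" for z using h that by blast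
  show h'd: "(h' has_field_derivative deriv h' z) (at z)" if "z \<in> D" for z
    by (rule holomorphic_derivI[OF h(2) D(1) that])
  show c'': "continuous_on D (deriv h')"
    using h(2) D(1) by (intro holomorphic_on_imp_continuous_on holomorphic_deriv)
  have ch: "continuous_on D h"
    by (intro continuous_at_imp_continuous_on ballI) (rule DERIV_isCont[OF h(1)])
  have ch': "continuous_on D h'" by (rule holomorphic_on_imp_continuous_on[OF h(2)])
  have cf: "continuous_on D f"
    by (intro continuous_at_imp_continuous_on ballI) (rule has_derivative_continuous[OF f(1)])
  have cP: "continuous_on D P"
    by (intro continuous_at_imp_continuous_on ballI) (rule has_derivative_continuous[OF P])
  show "continuous_on D (\<lambda>z. of_real (exp (2 * \<mu> * Re (h z))) * (of_real \<mu> * h' z * (P z + of_real \<mu> * h' z * of_real (f z))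
         + r z + of_real \<mu> * deriv h' z * of_real (f z) + of_real \<mu> * h' z * P z))"
    by (intro continuous_intros ch ch' cf cP c'' r)
  fix z assume z: "z \<in> D"
  have dh: "(h has_derivative (\<lambda>v. h' z * v)) (at z)" "(h' has_derivative (\<lambda>v. deriv h' z * v)) (at z)"
    using h(1)[OF z] h'd[OF z] by (simp_all add: has_field_derivative_def)
  define E where "E z = exp (2 * \<mu> * Re (h z))" for z
  have dE: "(E has_derivative (\<lambda>v. E z * (2 * \<mu> * Re (h' z * v)))) (at z)"
    unfolding E_def by (auto intro!: derivative_eq_intros dh)
  have "((\<lambda>z. E z * f z) has_derivative (\<lambda>v. E z * (2 * Re (P z * v)) + E z * (2 * \<mu> * Re (h' z * v)) * f z)) (at z)"
    by (rule has_derivative_mult[OF dE f(1)[OF z]])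
  then show "((\<lambda>z. exp (2 * \<mu> * Re (h z)) * f z) has_derivative
      (\<lambda>v. 2 * Re (of_real (exp (2 * \<mu> * Re (h z))) * (P z + of_real \<mu> * h' z * of_real (f z)) * v))) (at z)"
    unfolding E_def by (rule has_derivative_eq_rhs) (simp add: fun_eq_iff algebra_simps)
  have "((\<lambda>z. of_real (E z) * (P z + of_real \<mu> * h' z * of_real (f z))) has_derivative
      (\<lambda>v. of_real (E z) * ((r z * v + of_real (- 2 * \<mu> * Re (h' z * cnj (P z))) * cnj v)
          + (of_real \<mu> * h' z * of_real (2 * Re (P z * v)) + of_real \<mu> * (deriv h' z * v) * of_real (f z)))
        + of_real (E z * (2 * \<mu> * Re (h' z * v))) * (P z + of_real \<mu> * h' z * of_real (f z)))) (at z)"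
    by (intro has_derivative_mult has_derivative_add has_derivative_mult_right has_derivative_of_real dE P f dh z)
  moreover have "of_real (E z) * ((r z * v + of_real (- 2 * \<mu> * Re (h' z * cnj (P z))) * cnj v)
          + (of_real \<mu> * h' z * of_real (2 * Re (P z * v)) + of_real \<mu> * (deriv h' z * v) * of_real (f z)))
        + of_real (E z * (2 * \<mu> * Re (h' z * v))) * (P z + of_real \<mu> * h' z * of_real (f z))
     = of_real (E z) * (of_real \<mu> * h' z * (P z + of_real \<mu> * h' z * of_real (f z))
         + r z + of_real \<mu> * deriv h' z * of_real (f z) + of_real \<mu> * h' z * P z) * v
       + of_real (\<mu>\<^sup>2 * (norm (h' z))\<^sup>2 * (E z * f z)) * cnj v" for v
  proof -
    have 1: "complex_of_real (2 * \<mu> * Re x) = of_real \<mu> * (x + cnj x)"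
      "complex_of_real (- 2 * \<mu> * Re x) = - of_real \<mu> * (x + cnj x)"
      "complex_of_real (2 * Re x) = x + cnj x" for x :: complex
      by (simp_all add: complex_eq_iff)
    show ?thesis
      unfolding of_real_mult[of "E z"] of_real_mult[of "\<mu>\<^sup>2 * _"] of_real_mult[of "\<mu>\<^sup>2"] 1 complex_norm_square
      by (simp add: algebra_simps power2_eq_square)
  qed
  ultimately show "((\<lambda>z. of_real (exp (2 * \<mu> * Re (h z))) * (P z + of_real \<mu> * h' z * of_real (f z))) has_derivative
      (\<lambda>v. of_real (exp (2 * \<mu> * Re (h z))) * (of_real \<mu> * h' z * (P z + of_real \<mu> * h' z * of_real (f z))
         + r z + of_real \<mu> * deriv h' z * of_real (f z) + of_real \<mu> * h' z * P z) * v
       + of_real (\<mu>\<^sup>2 * (norm (h' z))\<^sup>2 * (exp (2 * \<mu> * Re (h z)) * f z)) * cnj v)) (at z)"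
    unfolding E_def by simp
qed

lemma component_representation:
  assumes D: "open D" "simply_connected D" "z0 \<in> D"
    and N: "neutral_connection \<mu>1 \<mu>2 C" and H: "harmonic_map_on C D \<phi>" and \<phi>0: "\<phi> z0 = 0"
    and h: "\<And>z. z \<in> D \<Longrightarrow> (h has_field_derivative h' z) (at z)" "h' holomorphic_on D" "h z0 = 0"
    and h': "\<And>z. z \<in> D \<Longrightarrow> wirtinger \<phi> 3 z = - 2 * h' z"
    and k: "(k, \<mu>) \<in> {(1, \<mu>1), (2, \<mu>2)}"
  obtains \<xi> where "\<xi> holomorphic_on D"
    and "\<And>z \<gamma>. valid_path \<gamma> \<Longrightarrow> pathstart \<gamma> = z0 \<Longrightarrow> pathfinish \<gamma> = z \<Longrightarrow> path_image \<gamma> \<subseteq> D \<Longrightarrow>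
      \<exists>f gp. iwasawa_decomposition (scalar_loop \<mu> \<xi> h' \<gamma>) f gp \<and>
         complex_of_real (\<phi> z $ k) = exp (- 2 * of_real \<mu> * of_real (Re (h z))) * (f (-1) - f 1)"
proof -
  have smooth: "smooth_map_on D \<phi>" using H by (simp add: harmonic_map_on_def)
  obtain r where r: "continuous_on D r"
    "\<And>z. z \<in> D \<Longrightarrow> ((\<lambda>w. \<phi> w $ k) has_derivative (\<lambda>v. 2 * Re (wirtinger \<phi> k z * v))) (at z)"
    "\<And>z. z \<in> D \<Longrightarrow> (wirtinger \<phi> k has_derivative
       (\<lambda>v. r z * v + of_real (laplacian \<phi> z $ k / 4) * cnj v)) (at z)"
    using smooth_wirtinger[OF D(1) smooth, of k] by blast
  have lap: "laplacian \<phi> z $ k / 4 = - 2 * \<mu> * Re (h' z * cnj (wirtinger \<phi> k z))" if "z \<in> D" for z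
    using harmonic_map_laplacian(2)[OF N H that k] h'[OF that] by (simp add: algebra_simps)
  interpret klein_gordon D z0 \<mu> h h' "deriv h'"
    "\<lambda>z. of_real (exp (2 * \<mu> * Re (h z))) * (wirtinger \<phi> k z + of_real \<mu> * h' z * of_real (\<phi> z $ k))"
    "\<lambda>z. of_real (exp (2 * \<mu> * Re (h z))) * (of_real \<mu> * h' z * (wirtinger \<phi> k z + of_real \<mu> * h' z * of_real (\<phi> z $ k))
         + r z + of_real \<mu> * deriv h' z * of_real (\<phi> z $ k) + of_real \<mu> * h' z * wirtinger \<phi> k z)"
    "\<lambda>z. exp (2 * \<mu> * Re (h z)) * \<phi> z $ k"
  proof (rule klein_gordon_of_harmonic[OF D(1,3) h r(2) _ _ r(1)])
    show "\<phi> z0 $ k = 0" by (simp add: \<phi>0)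
    show "(wirtinger \<phi> k has_derivative
       (\<lambda>v. r z * v + of_real (- 2 * \<mu> * Re (h' z * cnj (wirtinger \<phi> k z))) * cnj v)) (at z)" if "z \<in> D" for z
      using r(3)[OF that] unfolding lap[OF that] .
  qed
  obtain \<xi> where \<xi>: "\<xi> holomorphic_on D" and rep: "\<And>z J g. z \<in> D \<Longrightarrow>
       (\<And>\<zeta> x. norm \<zeta> = 1 \<Longrightarrow> x \<in> D \<Longrightarrow>
          (J \<zeta> has_field_derivative \<xi> x * exp (inverse \<zeta> * of_real \<mu> * h x)) (at x)) \<Longrightarrow>
       (\<And>\<zeta>. norm \<zeta> = 1 \<Longrightarrow> J \<zeta> z0 = 0) \<Longrightarrow>
       (\<And>\<zeta>. norm \<zeta> = 1 \<Longrightarrow>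
          g \<zeta> = inverse \<zeta> * exp (- of_real \<mu> * (inverse \<zeta> * h z + \<zeta> * cnj (h z))) * J \<zeta> z) \<Longrightarrow>
       \<exists>f gp. iwasawa_decomposition g f gp \<and> f (-1) - f 1 = of_real (exp (2 * \<mu> * Re (h z)) * \<phi> z $ k)"
    using simply_connected_representation[OF D(2)] by blast
  have "h holomorphic_on D" using h(1) D(1) by (auto simp: holomorphic_on_open)
  then have "(\<lambda>x. \<xi> x * exp (inverse \<zeta> * of_real \<mu> * h x)) holomorphic_on D" for \<zeta>
    by (intro holomorphic_intros \<xi>)
  then have "\<exists>J. \<forall>x. x \<in> D \<longrightarrow> (J has_field_derivative \<xi> x * exp (inverse \<zeta> * of_real \<mu> * h x)) (at x)" for \<zeta>
    using D simply_connected_eq_global_primitive[OF D(1)] by blast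
  then obtain J0 where J0: "\<And>\<zeta> x. x \<in> D \<Longrightarrow> (J0 \<zeta> has_field_derivative \<xi> x * exp (inverse \<zeta> * of_real \<mu> * h x)) (at x)"
    by metis
  define J where "J \<zeta> x = J0 \<zeta> x - J0 \<zeta> z0" for \<zeta> x
  have J: "(J \<zeta> has_field_derivative \<xi> x * exp (inverse \<zeta> * of_real \<mu> * h x)) (at x)" if "x \<in> D" for \<zeta> x
    unfolding J_def using DERIV_diff[OF J0[OF that] DERIV_const] by simp
  have Jb: "J \<zeta> z0 = 0" for \<zeta> by (simp add: J_def)
  show thesis
  proof (rule that[OF \<xi>])
    fix z \<gamma> assume \<gamma>: "valid_path \<gamma>" "pathstart \<gamma> = z0" "pathfinish \<gamma> = z" "path_image \<gamma> \<subseteq> D"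
    then have z: "z \<in> D" by (metis pathfinish_in_path_image subsetD)
    obtain f gp where "iwasawa_decomposition (scalar_loop \<mu> \<xi> h' \<gamma>) f gp"
      and f: "f (-1) - f 1 = of_real (exp (2 * \<mu> * Re (h z)) * \<phi> z $ k)"
      using rep[OF z J Jb scalar_loop_eq[OF h(1,3) J Jb \<gamma>(1,4,2,3)]] by blast
    moreover have "exp (- 2 * of_real \<mu> * of_real (Re (h z))) * (f (-1) - f 1) = complex_of_real (\<phi> z $ k)"
    proof -
      have "exp (- 2 * of_real \<mu> * of_real (Re (h z))) = complex_of_real (exp (- (2 * \<mu> * Re (h z))))"
        by (simp add: exp_of_real[symmetric])
      then show ?thesis unfolding f by (simp add: exp_minus)
    qed
    ultimately show "\<exists>f gp. iwasawa_decomposition (scalar_loop \<mu> \<xi> h' \<gamma>) f gp \<and>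
         complex_of_real (\<phi> z $ k) = exp (- 2 * of_real \<mu> * of_real (Re (h z))) * (f (-1) - f 1)"
      by metis
  qed
qed

theorem theorem6p5:
  fixes \<mu>1 \<mu>2 :: real and D :: "complex set" and z0 :: complex
    and \<phi> :: "complex \<Rightarrow> real^3" and C :: "(real^3) christoffel"
  assumes "open D" and "simply_connected D" and "z0 \<in> D"
    and "neutral_connection \<mu>1 \<mu>2 C"
    and "harmonic_map_on C D \<phi>"
    and "\<phi> z0 = 0"
  shows "\<exists>\<xi> :: 3 \<Rightarrow> complex \<Rightarrow> complex.
    (\<forall>k. \<xi> k nicely_meromorphic_on D \<and> \<not> is_pole (\<xi> k) z0) \<and>
    (\<forall>z \<gamma>. valid_path \<gamma> \<and> pathstart \<gamma> = z0 \<and> pathfinish \<gamma> = z \<and>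
        path_image \<gamma> \<subseteq> D - (\<Union>k. {w. is_pole (\<xi> k) w}) \<longrightarrow>
      (\<forall>(k, \<mu>) \<in> {(1, \<mu>1), (2, \<mu>2)}. \<exists>f gp.
         iwasawa_decomposition (scalar_loop \<mu> (\<xi> k) (\<xi> 3) \<gamma>) f gp \<and>
         complex_of_real (\<phi> z $ k) =
           exp (- 2 * of_real \<mu> * of_real (Re (contour_integral \<gamma> (\<xi> 3)))) * (f (-1) - f 1)) \<and>
      \<phi> z $ 3 = - 4 * Re (contour_integral \<gamma> (\<xi> 3)))"
proof -
  note D = assms(1-3) and N = assms(4) and H = assms(5) and \<phi>0 = assms(6)
  have smooth: "smooth_map_on D \<phi>" using H by (simp add: harmonic_map_on_def)
  obtain r where \<phi>3: "\<And>z. z \<in> D \<Longrightarrow> ((\<lambda>w. \<phi> w $ 3) has_derivative (\<lambda>v. 2 * Re (wirtinger \<phi> 3 z * v))) (at z)"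
    and r: "\<And>z. z \<in> D \<Longrightarrow> (wirtinger \<phi> 3 has_derivative
       (\<lambda>v. r z * v + of_real (laplacian \<phi> z $ 3 / 4) * cnj v)) (at z)"
    using smooth_wirtinger[OF D(1) smooth, of 3] by blast
  have "(wirtinger \<phi> 3 has_field_derivative r z) (at z)" if "z \<in> D" for z
    using r[OF that] harmonic_map_laplacian(1)[OF N H that] by (simp add: has_field_derivative_def)
  then have "wirtinger \<phi> 3 holomorphic_on D"
    using D(1) by (auto simp: holomorphic_on_open)
  then have hol3: "(\<lambda>z. - wirtinger \<phi> 3 z / 2) holomorphic_on D"
    by (intro holomorphic_intros) auto
  define h' where "h' z = - wirtinger \<phi> 3 z / 2" for z
  have h'hol: "h' holomorphic_on D" using hol3 by (simp add: h'_def[abs_def])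
  obtain h0 where h0: "\<And>z. z \<in> D \<Longrightarrow> (h0 has_field_derivative h' z) (at z)"
    using D h'hol simply_connected_eq_global_primitive[OF D(1)] by blast
  define h where "h z = h0 z - h0 z0" for z
  have h: "(h has_field_derivative h' z) (at z)" if "z \<in> D" for z
    unfolding h_def using DERIV_diff[OF h0[OF that] DERIV_const] by simp
  have hb: "h z0 = 0" by (simp add: h_def)
  have conn: "connected D" using D(2) by (rule simply_connected_imp_connected)
  have \<phi>3h: "\<phi> z $ 3 = - 4 * Re (h z)" if z: "z \<in> D" for z
  proof -
    have "(\<lambda>w. \<phi> w $ 3 + 4 * Re (h w)) z = (\<lambda>w. \<phi> w $ 3 + 4 * Re (h w)) z0"
    proof (rule has_derivative_zero_unique_connected[OF D(1) conn _ z D(3)])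
      fix x assume x: "x \<in> D"
      have dh: "(h has_derivative (\<lambda>v. h' x * v)) (at x)"
        using h[OF x] by (simp add: has_field_derivative_def)
      have "((\<lambda>w. \<phi> w $ 3 + 4 * Re (h w)) has_derivative
          (\<lambda>v. 2 * Re (wirtinger \<phi> 3 x * v) + 4 * Re (h' x * v))) (at x)"
        by (intro has_derivative_add \<phi>3[OF x] has_derivative_mult_right has_derivative_Re dh)
      then show "((\<lambda>w. \<phi> w $ 3 + 4 * Re (h w)) has_derivative (\<lambda>v. 0)) (at x)"
        by (rule has_derivative_eq_rhs) (simp add: h'_def fun_eq_iff)
    qed
    then show ?thesis by (simp add: hb \<phi>0)
  qed
  have h'w: "wirtinger \<phi> 3 z = - 2 * h' z" for z by (simp add: h'_def)
  note rep = component_representation[OF D N H \<phi>0 h h'hol hb h'w]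
  obtain \<xi>1 where \<xi>1: "\<xi>1 holomorphic_on D"
    "\<And>z \<gamma>. valid_path \<gamma> \<Longrightarrow> pathstart \<gamma> = z0 \<Longrightarrow> pathfinish \<gamma> = z \<Longrightarrow> path_image \<gamma> \<subseteq> D \<Longrightarrow>
      \<exists>f gp. iwasawa_decomposition (scalar_loop \<mu>1 \<xi>1 h' \<gamma>) f gp \<and>
         complex_of_real (\<phi> z $ 1) = exp (- 2 * of_real \<mu>1 * of_real (Re (h z))) * (f (-1) - f 1)"
    using rep[of 1 \<mu>1] by blast
  obtain \<xi>2 where \<xi>2: "\<xi>2 holomorphic_on D"
    "\<And>z \<gamma>. valid_path \<gamma> \<Longrightarrow> pathstart \<gamma> = z0 \<Longrightarrow> pathfinish \<gamma> = z \<Longrightarrow> path_image \<gamma> \<subseteq> D \<Longrightarrow>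
      \<exists>f gp. iwasawa_decomposition (scalar_loop \<mu>2 \<xi>2 h' \<gamma>) f gp \<and>
         complex_of_real (\<phi> z $ 2) = exp (- 2 * of_real \<mu>2 * of_real (Re (h z))) * (f (-1) - f 1)"
    using rep[of 2 \<mu>2] by blast
  define \<xi> :: "3 \<Rightarrow> complex \<Rightarrow> complex" where "\<xi> k = (if k = 1 then \<xi>1 else if k = 2 then \<xi>2 else h')" for k
  have \<xi>: "\<xi> 1 = \<xi>1" "\<xi> 2 = \<xi>2" "\<xi> 3 = h'" by (simp_all add: \<xi>_def)
  have "\<xi> k analytic_on D" for k
    using \<xi>1(1) \<xi>2(1) h'hol D(1) by (simp add: \<xi>_def analytic_on_open)
  then have mero: "\<xi> k nicely_meromorphic_on D \<and> \<not> is_pole (\<xi> k) z0" for k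
    using D(3) analytic_on_imp_nicely_meromorphic_on analytic_at_imp_no_pole analytic_on_analytic_at by blast
  show ?thesis
  proof (intro exI[of _ \<xi>] conjI allI impI)
    show "\<xi> k nicely_meromorphic_on D" "\<not> is_pole (\<xi> k) z0" for k using mero by auto
    fix z \<gamma>
    assume "valid_path \<gamma> \<and> pathstart \<gamma> = z0 \<and> pathfinish \<gamma> = z \<and>
        path_image \<gamma> \<subseteq> D - (\<Union>k. {w. is_pole (\<xi> k) w})"
    then have \<gamma>: "valid_path \<gamma>" "pathstart \<gamma> = z0" "pathfinish \<gamma> = z" "path_image \<gamma> \<subseteq> D" by auto
    then have z: "z \<in> D" by (metis pathfinish_in_path_image subsetD)
    have int: "contour_integral \<gamma> h' = h z"
      using contour_integral_primitive[of D h h' \<gamma>] h hb \<gamma>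
      by (auto intro!: contour_integral_unique simp: has_field_derivative_at_within)
    show "\<phi> z $ 3 = - 4 * Re (contour_integral \<gamma> (\<xi> 3))"
      unfolding \<xi> int by (rule \<phi>3h[OF z])
    show "\<forall>(k, \<mu>) \<in> {(1, \<mu>1), (2, \<mu>2)}. \<exists>f gp.
         iwasawa_decomposition (scalar_loop \<mu> (\<xi> k) (\<xi> 3) \<gamma>) f gp \<and>
         complex_of_real (\<phi> z $ k) =
           exp (- 2 * of_real \<mu> * of_real (Re (contour_integral \<gamma> (\<xi> 3)))) * (f (-1) - f 1)"
      using \<xi>1(2)[OF \<gamma>] \<xi>2(2)[OF \<gamma>] by (simp add: \<xi> int)
  qed
qed

end
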